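(* (1) There are exactly $14$ distinct geometric Apollonian super-packings (not identified under Euclidean motions) that are super-integral. (2) The set of ordered, oriented Descartes configurations $\mathcal D$ whose augmented curvature-center coordinate matrix $W_{\mathcal D}$ is an integer matrix is the union of exactly $672$ orbits of the super-Apollonian group $\mathcal A^S$.
   Context: Circles are taken in $\hat{\mathbb C}=\mathbb R^2\cup\{\infty\}$; lines count as circles. A Descartes configuration is a set of four mutually tangent circles with disjoint interiors; an ordered, oriented one carries an ordering and a total orientation (48 choices per unordered configuration), with signed curvatures $b_i$ (reciprocal radius, negative if the interior is unbounded, $0$ for lines, all reversed for negative orientation). The augmented curvature-center coordinate matrix $W_{\mathcal D}$ has $i$-th row $(\bar b_i,b_i,b_ix_i,b_iy_i)$, where $(x_i,y_i)$ is the center of the $i$-th circle and $\bar b_i=b_i(x_i^2+y_i^2)-1/b_i$ is the signed curvature of its image under inversion in the unit circle (for a line: $(2p\cdot n,0,n_x,n_y)$ with $n$ the unit normal pointing into its interior half-plane and $p$ a point of the line); it determines $\mathcal D$. Let $S_i$ be the $4\times4$ integer matrix equal to the identity except that row $i$ has $-1$ in position $i$ and $2$ elsewhere, $S_i^\perp=S_i^T$, and $\mathcal A^S=\langle S_1,\dots,S_4,S_1^\perp,\dots,S_4^\perp\rangle$, acting by $W_{U[\mathcal D]}=UW_{\mathcal D}$. The geometric super-packing generated by $\mathcal D$ is the set of circles of configurations in $\mathcal A^S[\mathcal D]$; it is super-integral if $W_{\mathcal D}$ is an integer matrix for one (equivalently all) configurations in the orbit. *)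

theory Defs
  imports "HOL-Analysis.Analysis"
begin

text \<open>Oriented circles in the extended plane, identified with the complex plane
  (the point at infinity is implicit).  An oriented circle is given by its interior:
  an open disk (Disk c r), the complement of a closed disk (CoDisk c r), or an open
  half-plane (Half n d) = {z. n \<bullet> z > d} with unit normal n pointing into it.\<close>

datatype ocircle = Disk complex real | CoDisk complex real | Half complex real

fun valid_oc :: "ocircle \<Rightarrow> bool" where
  "valid_oc (Disk c r) = (r > 0)"
| "valid_oc (CoDisk c r) = (r > 0)"
| "valid_oc (Half n d) = (norm n = 1)"

fun oc_interior :: "ocircle \<Rightarrow> complex set" where
  "oc_interior (Disk c r) = ball c r"
| "oc_interior (CoDisk c r) = - cball c r"
| "oc_interior (Half n d) = {z. n \<bullet> z > d}"

fun circ_set :: "ocircle \<Rightarrow> complex set" where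
  "circ_set (Disk c r) = sphere c r"
| "circ_set (CoDisk c r) = sphere c r"
| "circ_set (Half n d) = {z. n \<bullet> z = d}"

fun flip_oc :: "ocircle \<Rightarrow> ocircle" where
  "flip_oc (Disk c r) = CoDisk c r"
| "flip_oc (CoDisk c r) = Disk c r"
| "flip_oc (Half n d) = Half (- n) (- d)"

text \<open>Two circles are tangent iff they are distinct and meet in exactly one point of
  the extended plane; two lines (the unbounded circles) also meet at infinity.\<close>
definition tangent :: "complex set \<Rightarrow> complex set \<Rightarrow> bool" where
  "tangent A B \<longleftrightarrow> A \<noteq> B \<and>
     (if \<not> bounded A \<and> \<not> bounded B then A \<inter> B = {} else card (A \<inter> B) = 1)"

definition pos_descartes :: "(4 \<Rightarrow> ocircle) \<Rightarrow> bool" where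
  "pos_descartes D \<longleftrightarrow> (\<forall>i. valid_oc (D i)) \<and>
     (\<forall>i j. i \<noteq> j \<longrightarrow> oc_interior (D i) \<inter> oc_interior (D j) = {}
                   \<and> tangent (circ_set (D i)) (circ_set (D j)))"

definition oo_descartes :: "(4 \<Rightarrow> ocircle) \<Rightarrow> bool" where
  "oo_descartes D \<longleftrightarrow> pos_descartes D \<or> pos_descartes (flip_oc \<circ> D)"

text \<open>Row (bbar, b, b x, b y) of the augmented curvature-center coordinate matrix.\<close>
fun wrow :: "ocircle \<Rightarrow> real^4" where
  "wrow (Disk c r) = (let b = 1 / r in
      vector [b * (norm c)\<^sup>2 - 1 / b, b, b * Re c, b * Im c])"
| "wrow (CoDisk c r) = (let b = - 1 / r in
      vector [b * (norm c)\<^sup>2 - 1 / b, b, b * Re c, b * Im c])"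
| "wrow (Half n d) = vector [2 * d, 0, Re n, Im n]"

definition Wmat :: "(4 \<Rightarrow> ocircle) \<Rightarrow> real^4^4" where
  "Wmat D = (\<chi> i. wrow (D i))"

definition integral_W :: "(4 \<Rightarrow> ocircle) \<Rightarrow> bool" where
  "integral_W D \<longleftrightarrow> (\<forall>i j. Wmat D $ i $ j \<in> \<int>)"

definition Smat :: "4 \<Rightarrow> real^4^4" where
  "Smat i = (\<chi> r c. if r = i then (if c = i then -1 else 2) else (if r = c then 1 else 0))"

inductive_set superA :: "(real^4^4) set" where
  one: "mat 1 \<in> superA"
| gen: "U \<in> superA \<Longrightarrow> Smat i ** U \<in> superA"
| genT: "U \<in> superA \<Longrightarrow> transpose (Smat i) ** U \<in> superA"
| gen_inv: "U \<in> superA \<Longrightarrow> matrix_inv (Smat i) ** U \<in> superA"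
| genT_inv: "U \<in> superA \<Longrightarrow> matrix_inv (transpose (Smat i)) ** U \<in> superA"

definition superA_orbit :: "(4 \<Rightarrow> ocircle) \<Rightarrow> (4 \<Rightarrow> ocircle) set" where
  "superA_orbit D = {D'. oo_descartes D' \<and> (\<exists>U \<in> superA. Wmat D' = U ** Wmat D)}"

definition super_packing :: "(4 \<Rightarrow> ocircle) \<Rightarrow> complex set set" where
  "super_packing D = (\<Union>D' \<in> superA_orbit D. range (\<lambda>i. circ_set (D' i)))"

end

(*
  The rows of W are vectors of norm 1 for a quadratic form of signature (3,1), and the
  four rows of a Descartes configuration have the Gram matrix K with diagonal 1 and entries -1
  elsewhere.

  An integer matrix U with U K U^T = K is, up to sign, a permutation matrix multiplied by an element
  of the super-Apollonian group. To see this, reduce the sum of the entries of U by left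
  multiplication with the generators: the vector x of row sums satisfies x^T K x = -8 and has odd
  entries, and if no generator reduces the sum then x = (1,1,1,1), which forces U to be a permutation
  matrix. Hence all configurations whose rows lie in the lattice spanned by the rows of a fixed one
  form 48 orbits: 24 permutations and 2 signs, distinguished by U modulo 2 and by time orientation.

  Modulo 4 (for the first two entries) and 2 (for the last two), an integral row has 20 possible
  residues, and pairwise compatible residues always lie in one of 14 lattices. Each lattice is
  spanned by the rows of an explicit configuration of two lines and two equal circles. A super-packing
  determines its lattice, and permuting or flipping a configuration does not change its packing.
*)

theory Submission
  imports Defs
begin

subsection \<open>Tangency as a Gram matrix\<close>

lemma vector_4 [simp]:
  "(vector [x,y,z,w] :: ('a::zero)^4) $ 1 = x"
  "(vector [x,y,z,w] :: ('a::zero)^4) $ 2 = y"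
  "(vector [x,y,z,w] :: ('a::zero)^4) $ 3 = z"
  "(vector [x,y,z,w] :: ('a::zero)^4) $ 4 = w"
  unfolding vector_def by simp_all

lemma vec4_eq_iff: "x = (y :: 'a^4) \<longleftrightarrow> x$1 = y$1 \<and> x$2 = y$2 \<and> x$3 = y$3 \<and> x$4 = y$4"
  by (simp add: vec_eq_iff forall_4)

text \<open>The bilinear form for which row vectors of oriented circles have norm \<open>1\<close>
  and externally tangent circles have product \<open>-1\<close>.\<close>
definition bil :: "real^4 \<Rightarrow> real^4 \<Rightarrow> real" where
  "bil r s = r$3 * s$3 + r$4 * s$4 - (r$1 * s$2 + r$2 * s$1) / 2"

lemma bil_commute: "bil r s = bil s r"
  by (simp add: bil_def algebra_simps)

lemma bil_minus [simp]: "bil (- r) (- s) = bil r s"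
  by (simp add: bil_def)

lemma wrow_flip: "valid_oc C \<Longrightarrow> wrow (flip_oc C) = - wrow C"
  by (cases C) (auto simp: vec4_eq_iff field_simps)

lemma valid_flip [simp]: "valid_oc (flip_oc C) = valid_oc C"
  by (cases C) auto

lemma flip_flip [simp]: "flip_oc (flip_oc C) = C"
  by (cases C) auto

lemma circ_set_flip [simp]: "circ_set (flip_oc C) = circ_set C"
proof (cases C)
  case (Half n d)
  have "(- (n \<bullet> z) = - d) = (n \<bullet> z = d)" for z by linarith
  then show ?thesis using Half by (simp add: inner_minus_left)
qed auto

lemma norm_complex_1: "norm (n::complex) = 1 \<longleftrightarrow> (Re n)\<^sup>2 + (Im n)\<^sup>2 = 1"
  by (simp add: cmod_def)

section \<open>Products of rows in terms of radii and distances\<close>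

lemma bil_wrow_self: "valid_oc C \<Longrightarrow> bil (wrow C) (wrow C) = 1"
proof (cases C)
  case (Disk c r)
  assume "valid_oc C"
  with Disk show ?thesis
    by (simp add: bil_def cmod_power2 field_simps) (simp add: power2_eq_square algebra_simps)
next
  case (CoDisk c r)
  assume "valid_oc C"
  with CoDisk show ?thesis
    by (simp add: bil_def cmod_power2 field_simps) (simp add: power2_eq_square algebra_simps)
qed (auto simp: bil_def norm_complex_1 power2_eq_square)

text \<open>The inversive product of two circles; for positive radii it equals -1 exactly when
  \<open>dist c d = r + s\<close>, that is, at external tangency.\<close>

lemma bil_Disk_Disk:
  assumes "r > 0" "s > 0"
  shows "bil (wrow (Disk c r)) (wrow (Disk d s)) = (r\<^sup>2 + s\<^sup>2 - (dist c d)\<^sup>2) / (2 * r * s)"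
  using assms
  by (simp add: bil_def dist_norm cmod_power2 field_simps) (simp add: power2_eq_square algebra_simps)

lemma bil_Disk_CoDisk:
  assumes "r > 0" "s > 0"
  shows "bil (wrow (Disk c r)) (wrow (CoDisk d s)) = - (r\<^sup>2 + s\<^sup>2 - (dist c d)\<^sup>2) / (2 * r * s)"
  using assms
  by (simp add: bil_def dist_norm cmod_power2 field_simps) (simp add: power2_eq_square algebra_simps)

lemma bil_Disk_Half:
  assumes "r > 0"
  shows "bil (wrow (Disk c r)) (wrow (Half n d)) = (n \<bullet> c - d) / r"
  using assms by (simp add: bil_def inner_complex_def field_simps)

section \<open>Disjoint interiors as inequalities\<close>

lemma ball_in_halfplane:
  fixes c n :: complex
  assumes "r > 0" "norm n = 1" "ball c r \<inter> {z. n \<bullet> z > d} = {}"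
  shows "n \<bullet> c + r \<le> d"
proof (rule ccontr)
  assume "\<not> ?thesis"
  then have a: "n \<bullet> c + r > d" by simp
  \<comment> \<open>Half-way between the displacement \<open>d - n \<bullet> c\<close> needed to
    reach the half-plane and the radius, cut off at 0 so that it is a length.\<close>
  define t where "t = max 0 ((d - n \<bullet> c + r) / 2)"
  have t: "0 \<le> t" "t < r" "n \<bullet> c + t > d"
    using a assms(1) by (auto simp: t_def max_def field_simps split: if_splits)
  have nn: "n \<bullet> n = 1" using assms(2) by (simp add: dot_square_norm)
  have "c + t *\<^sub>R n \<in> ball c r" using t assms(2) by (simp add: dist_norm)
  moreover have "n \<bullet> (c + t *\<^sub>R n) > d" using t nn by (simp add: inner_add_right)
  ultimately show False using assms(3) by blast
qed

lemma disjoint_balls_dist: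
  fixes c d :: complex
  assumes "r > 0" "s > 0" "ball c r \<inter> ball d s = {}"
  shows "r + s \<le> dist c d"
proof (rule ccontr)
  assume "\<not> ?thesis"
  then have a: "dist c d < r + s" by simp
  \<comment> \<open>The point dividing the segment between the centres in the ratio r : s lies
    within both radii.\<close>
  define t where "t = r / (r + s)"
  define z where "z = c + t *\<^sub>R (d - c)"
  have "dist c z = t * dist c d" using assms by (simp add: z_def t_def dist_norm norm_minus_commute)
  also have "\<dots> < r" using a assms mult_strict_left_mono[OF a, of t] by (simp add: t_def)
  finally have 1: "z \<in> ball c r" by simp
  have "d - z = (1 - t) *\<^sub>R (d - c)" by (simp add: z_def algebra_simps)
  moreover have "1 - t = s / (r + s)" using assms by (simp add: t_def field_simps)
  ultimately have "dist d z = s / (r + s) * dist c d"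
    using assms by (simp add: dist_norm norm_minus_commute)
  also have "\<dots> < s" using a assms mult_strict_left_mono[OF a, of "s / (r + s)"] by simp
  finally have "z \<in> ball d s" by simp
  with 1 assms(3) show False by blast
qed

lemma line_unbounded:
  fixes n :: complex
  assumes "norm n = 1"
  shows "\<not> bounded {z. n \<bullet> z = d}"
proof
  assume "bounded {z. n \<bullet> z = d}"
  then obtain B where B: "\<And>z. n \<bullet> z = d \<Longrightarrow> norm z \<le> B" by (auto simp: bounded_iff)
  have nn: "n \<bullet> n = 1" using assms by (simp add: dot_square_norm)
  have i: "n \<bullet> (\<i> * n) = 0" by (simp add: inner_complex_def)
  \<comment> \<open>Far enough along the line that the norm, at least
    \<open>t - \<bar>d\<bar>\<close>, exceeds \<open>B\<close>.\<close>
  define t where "t = \<bar>B\<bar> + \<bar>d\<bar> + 1"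
  have "n \<bullet> (d *\<^sub>R n + t *\<^sub>R (\<i> * n)) = d" using nn i by (simp add: inner_add_right)
  from B[OF this] have "norm (d *\<^sub>R n + t *\<^sub>R (\<i> * n)) \<le> B" .
  moreover have "norm (t *\<^sub>R (\<i> * n)) - norm (d *\<^sub>R n) \<le> norm (d *\<^sub>R n + t *\<^sub>R (\<i> * n))"
    by (metis add.commute norm_diff_ineq)
  ultimately show False using assms by (simp add: norm_mult t_def)
qed

lemma halfplane_unbounded:
  fixes n :: complex
  assumes "norm n = 1"
  shows "\<not> bounded {z. n \<bullet> z > d}"
proof
  assume "bounded {z. n \<bullet> z > d}"
  then have "bounded {z. n \<bullet> z = d + 1}" by (rule bounded_subset) auto
  with line_unbounded[OF assms] show False by blast
qed

lemma sphere_bounded [simp]: "bounded (sphere (c::complex) r)"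
  by (rule bounded_subset[OF bounded_cball[of c r]]) auto

lemma disjoint_half_planes:
  fixes n m :: complex
  assumes "norm n = 1" "norm m = 1" "{z. n \<bullet> z > d} \<inter> {z. m \<bullet> z > e} = {}"
    and "{z. n \<bullet> z = d} \<inter> {z. m \<bullet> z = e} = {}"
  shows "n \<bullet> m = - 1"
proof -
  \<comment> \<open>Determinant of the two normals; if it is nonzero, Cramer's rule gives a common
    point of the lines.\<close>
  define D where "D = Re n * Im m - Im n * Re m"
  have "D = 0"
  proof (rule ccontr)
    assume "D \<noteq> 0"
    define z where "z = Complex ((d * Im m - e * Im n) / D) ((Re n * e - Re m * d) / D)"
    have "n \<bullet> z = (d * (Re n * Im m - Im n * Re m)) / D"
      using \<open>D \<noteq> 0\<close> by (simp add: z_def inner_complex_def field_simps)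
    moreover have "m \<bullet> z = (e * (Re n * Im m - Im n * Re m)) / D"
      using \<open>D \<noteq> 0\<close> by (simp add: z_def inner_complex_def field_simps)
    ultimately have "z \<in> {z. n \<bullet> z = d} \<inter> {z. m \<bullet> z = e}"
      using \<open>D \<noteq> 0\<close> by (simp flip: D_def)
    with assms(4) show False by blast
  qed
  \<comment> \<open>Lagrange's identity: with \<open>D = 0\<close> the unit normals are parallel or
    antiparallel.\<close>
  have "(n \<bullet> m)\<^sup>2 + D\<^sup>2 = ((Re n)\<^sup>2 + (Im n)\<^sup>2) * ((Re m)\<^sup>2 + (Im m)\<^sup>2)"
    by (simp add: D_def inner_complex_def power2_eq_square algebra_simps)
  with \<open>D = 0\<close> assms(1,2) have "(n \<bullet> m)\<^sup>2 = 1" by (simp add: norm_complex_1)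
  moreover have "n \<bullet> m \<noteq> 1"
  proof
    assume nm: "n \<bullet> m = 1"
    have nn: "n \<bullet> n = 1" using assms by (simp add: dot_square_norm)
    \<comment> \<open>If the normals agreed, both half-planes would contain all far points in
      direction \<open>n\<close>.\<close>
    let ?z = "(\<bar>d\<bar> + \<bar>e\<bar> + 1) *\<^sub>R n"
    have "?z \<in> {z. n \<bullet> z > d} \<inter> {z. m \<bullet> z > e}"
      using nm nn by (simp add: inner_commute) arith
    with assms(3) show False by blast
  qed
  ultimately show ?thesis by (auto simp: power2_eq_1_iff)
qed

lemma tangent_meet:
  assumes "tangent A B" "bounded A \<or> bounded B"
  obtains z where "z \<in> A" "z \<in> B"
proof -
  have "card (A \<inter> B) = 1" using assms by (auto simp: tangent_def split: if_splits)
  then have "A \<inter> B \<noteq> {}" by force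
  then show thesis using that by blast
qed

lemma tangent_commute: "tangent A B = tangent B A"
  by (auto simp: tangent_def Int_commute)

text \<open>Disjointness of the interiors bounds the distance between the centres (or from centre to
  line) on one side, a common point bounds it on the other. The resulting equality makes the product
  -1.\<close>

lemma bil_Disk_tangent:
  assumes r: "r > 0" and C: "valid_oc C" "ball c r \<inter> oc_interior C = {}"
    "tangent (sphere c r) (circ_set C)"
  shows "bil (wrow (Disk c r)) (wrow C) = -1"
proof -
  obtain z where z: "z \<in> sphere c r" "z \<in> circ_set C"
    using tangent_meet[OF C(3)] by auto
  show ?thesis
  proof (cases C)
    case (Disk d s)
    then have s: "s > 0" using C by simp
    have "r + s \<le> dist c d" using disjoint_balls_dist[OF r s] C Disk by simp
    moreover have "dist c d \<le> r + s"
      using z Disk dist_triangle[of c d z] by (simp add: dist_commute)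
    ultimately have "dist c d = r + s" by simp
    then show ?thesis unfolding Disk bil_Disk_Disk[OF r s] using r s
      by (simp add: field_simps power2_eq_square)
  next
    case (CoDisk d s)
    then have s: "s > 0" using C by simp
    have "ball c r \<subseteq> cball d s" using C CoDisk by auto
    then have "dist c d + r \<le> s" using r by (simp add: ball_subset_cball_iff)
    moreover have "s \<le> dist c d + r"
      using z CoDisk dist_triangle[of d z c] by (simp add: dist_commute)
    ultimately have e: "dist c d = s - r" by simp
    have "r\<^sup>2 + s\<^sup>2 - (dist c d)\<^sup>2 = 2 * r * s"
      unfolding e by (simp add: power2_eq_square algebra_simps)
    then show ?thesis unfolding CoDisk bil_Disk_CoDisk[OF r s] using r s by simp
  next
    case (Half n d)
    then have n: "norm n = 1" using C by simp
    have "n \<bullet> c + r \<le> d" using ball_in_halfplane[OF r n] C Half by simp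
    moreover have "d - n \<bullet> c \<le> r"
    proof -
      have "d - n \<bullet> c = n \<bullet> (z - c)" using z Half by (simp add: inner_diff_right)
      also have "\<dots> \<le> norm n * norm (z - c)" by (rule norm_cauchy_schwarz)
      also have "\<dots> = r" using z n by (simp add: dist_norm norm_minus_commute)
      finally show ?thesis .
    qed
    ultimately have "n \<bullet> c - d = - r" by simp
    then show ?thesis unfolding Half bil_Disk_Half[OF r] using r by simp
  qed
qed

text \<open>Symmetry reduces every pair containing a \<open>Disk\<close> to
  \<open>bil_Disk_tangent\<close>. Two disjoint unbounded interiors can only be half-planes, as the
  complement of a disk contains all far points.\<close>

lemma bil_tangent:
  assumes "valid_oc C" "valid_oc C'" "oc_interior C \<inter> oc_interior C' = {}"
    "tangent (circ_set C) (circ_set C')"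
  shows "bil (wrow C) (wrow C') = -1"
proof (cases C)
  case (Disk c r)
  then show ?thesis using bil_Disk_tangent[of r C' c] assms by simp
next
  case C: (CoDisk c r)
  show ?thesis
  proof (cases C')
    case (Disk d s)
    then show ?thesis using bil_Disk_tangent[of s C d] assms
      by (simp add: bil_commute tangent_commute Int_commute)
  next
    case (CoDisk d s)
    then have "cball c r \<union> cball d s = UNIV" using assms C by auto
    moreover have "bounded (cball c r \<union> cball d s)" by simp
    ultimately show ?thesis using not_bounded_UNIV by metis
  next
    case (Half n d)
    then have "{z. n \<bullet> z > d} \<subseteq> cball c r" using assms C by auto
    then show ?thesis using halfplane_unbounded[of n d] bounded_subset[OF bounded_cball] Half assms
      by auto
  qed
next
  case C: (Half m e)
  show ?thesis
  proof (cases C')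
    case (Disk d s)
    then show ?thesis using bil_Disk_tangent[of s C d] assms
      by (simp add: bil_commute tangent_commute Int_commute)
  next
    case (CoDisk d s)
    then have "{z. m \<bullet> z > e} \<subseteq> cball d s" using assms C by auto
    then show ?thesis using halfplane_unbounded[of m e] bounded_subset[OF bounded_cball] C assms
      by auto
  next
    case (Half n d)
    have "m \<bullet> n = -1"
    proof (rule disjoint_half_planes)
      show "norm m = 1" "norm n = 1" using assms C Half by auto
      then show "{z. m \<bullet> z = e} \<inter> {z. n \<bullet> z = d} = {}"
        using assms(4) C Half line_unbounded by (simp add: tangent_def)
      show "{z. m \<bullet> z > e} \<inter> {z. n \<bullet> z > d} = {}" using assms(3) C Half by simp
    qed
    then show ?thesis using C Half by (simp add: bil_def inner_complex_def)
  qed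
qed

lemma oo_descartes_valid: "oo_descartes D \<Longrightarrow> valid_oc (D i)"
  by (auto simp: oo_descartes_def pos_descartes_def)

text \<open>Total reversal negates every row, so both orientations have the same Gram
  matrix.\<close>

lemma oo_descartes_bil:
  assumes "oo_descartes D"
  shows "bil (wrow (D i)) (wrow (D j)) = (if i = j then 1 else -1)"
proof (cases "i = j")
  case True
  then show ?thesis using bil_wrow_self oo_descartes_valid[OF assms] by simp
next
  case False
  have v: "valid_oc (D i)" "valid_oc (D j)" using oo_descartes_valid[OF assms] by auto
  consider "pos_descartes D" | "pos_descartes (flip_oc \<circ> D)" using assms oo_descartes_def by blast
  then show ?thesis
  proof cases
    case 1
    then show ?thesis using False bil_tangent[OF v] by (simp add: pos_descartes_def)
  next
    case 2
    then have "bil (wrow (flip_oc (D i))) (wrow (flip_oc (D j))) = -1"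
      using False v by (intro bil_tangent) (auto simp: pos_descartes_def)
    then show ?thesis using False by (simp add: wrow_flip v)
  qed
qed

section \<open>Recovering an oriented circle from its point set\<close>

lemma sphere_inj:
  fixes c d :: complex
  assumes "r > 0" "s > 0" "sphere c r = sphere d s"
  shows "c = d \<and> r = s"
proof -
  have "(dist d z)\<^sup>2 = s\<^sup>2" if "dist c z = r" for z
    using assms(3) that by (auto simp: set_eq_iff)
  \<comment> \<open>The end points of the horizontal and the vertical diameter; subtracting the
    equations of opposite points isolates the coordinates of the centre.\<close>
  from this[of "c + of_real r"] this[of "c - of_real r"]
    this[of "c + \<i> * of_real r"] this[of "c - \<i> * of_real r"]
  have e: "(Re d - Re c - r)\<^sup>2 + (Im d - Im c)\<^sup>2 = s\<^sup>2" "(Re d - Re c + r)\<^sup>2 + (Im d - Im c)\<^sup>2 = s\<^sup>2"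
    "(Re d - Re c)\<^sup>2 + (Im d - Im c - r)\<^sup>2 = s\<^sup>2" "(Re d - Re c)\<^sup>2 + (Im d - Im c + r)\<^sup>2 = s\<^sup>2"
    using assms(1) by (simp_all add: dist_norm cmod_power2 norm_mult algebra_simps)
  have "4 * (r * (Re d - Re c)) = ((Re d - Re c + r)\<^sup>2 + (Im d - Im c)\<^sup>2)
      - ((Re d - Re c - r)\<^sup>2 + (Im d - Im c)\<^sup>2)"
    "4 * (r * (Im d - Im c)) = ((Re d - Re c)\<^sup>2 + (Im d - Im c + r)\<^sup>2)
      - ((Re d - Re c)\<^sup>2 + (Im d - Im c - r)\<^sup>2)"
    by (simp_all add: power2_eq_square algebra_simps)
  then have "r * (Re d - Re c) = 0" "r * (Im d - Im c) = 0" using e by simp_all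
  then have "c = d" using assms(1) by (auto simp: complex_eq_iff)
  moreover from this have "r\<^sup>2 = s\<^sup>2" using e(1) by simp
  ultimately show ?thesis using assms by (simp add: power2_eq_iff_nonneg)
qed

text \<open>Super-packings consist of unoriented circles, so the row has to be recovered, up to
  sign, from the point set.\<close>

lemma wrow_eq_of_circ_set:
  assumes "valid_oc C" "valid_oc C'" "circ_set C = circ_set C'"
  shows "C' = C \<or> C' = flip_oc C"
proof -
  have sph: "c = d \<and> r = s" if "r > 0" "s > 0" "sphere c r = sphere d s" for c d :: complex and r s
    using sphere_inj[OF that] .
  have neq: "sphere c r \<noteq> {z. n \<bullet> z = e}" if "norm n = 1" for c n :: complex and r e
    using line_unbounded[OF that, of e] sphere_bounded[of c r] by metis
  show ?thesis
  proof (cases C)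
    case (Disk c r)
    then show ?thesis using assms neq by (cases C') (auto dest: sph)
  next
    case (CoDisk c r)
    then show ?thesis using assms neq by (cases C') (auto dest: sph)
  next
    case (Half n d)
    show ?thesis
    proof (cases C')
      case H: (Half m e)
      have n: "norm n = 1" and m: "norm m = 1" using Half H assms by auto
      have nn: "n \<bullet> n = 1" using n by (simp add: dot_square_norm)
      have eq: "n \<bullet> z = d \<longleftrightarrow> m \<bullet> z = e" for z using assms(3) Half H by auto
      have i: "n \<bullet> (\<i> * n) = 0" by (simp add: inner_complex_def)
      \<comment> \<open>Two points of the line that differ by \<open>\<i> * n\<close>; this
        difference is orthogonal to \<open>m\<close>, so \<open>m\<close> is a real multiple
        \<open>k\<close> of \<open>n\<close>.\<close>
      have 1: "m \<bullet> (d *\<^sub>R n) = e" using eq[of "d *\<^sub>R n"] nn by simp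
      have "m \<bullet> (d *\<^sub>R n + \<i> * n) = e" using eq[of "d *\<^sub>R n + \<i> * n"] nn i by (simp add: inner_add_right)
      with 1 have "m \<bullet> (\<i> * n) = 0" by (simp add: inner_add_right)
      then have D: "Im m * Re n = Re m * Im n" by (simp add: inner_complex_def algebra_simps)
      have nm: "(Re n)\<^sup>2 + (Im n)\<^sup>2 = 1" "(Re m)\<^sup>2 + (Im m)\<^sup>2 = 1" using n m by (auto simp: norm_complex_1)
      define k where "k = m \<bullet> n"
      have "Re m * ((Re n)\<^sup>2 + (Im n)\<^sup>2) = k * Re n" "Im m * ((Re n)\<^sup>2 + (Im n)\<^sup>2) = k * Im n"
        using D by (simp_all add: k_def inner_complex_def power2_eq_square algebra_simps)
      then have mk: "Re m = k * Re n" "Im m = k * Im n" using nm by simp_all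
      then have "k\<^sup>2 * ((Re n)\<^sup>2 + (Im n)\<^sup>2) = 1" using nm(2) by (simp add: algebra_simps power_mult_distrib)
      then have "k = 1 \<or> k = -1" using nm by (simp add: power2_eq_1_iff)
      moreover have "e = k * d" using 1 k_def by (simp add: mult.commute)
      moreover have "m = k *\<^sub>R n" using mk by (simp add: complex_eq_iff)
      ultimately show ?thesis using Half H by auto
    qed (use Half assms neq in \<open>auto dest: sym\<close>)
  qed
qed

subsection \<open>The super-Apollonian group\<close>

text \<open>Twice the matrix I - J/2 of the Descartes quadratic form, J being the all-ones
  matrix.\<close>

definition Kmat :: "real^4^4" where
  "Kmat = (\<chi> i j. if i = j then 1 else -1)"

definition isoK :: "real^4^4 \<Rightarrow> bool" where
  "isoK U \<longleftrightarrow> U ** Kmat ** transpose U = Kmat"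

definition int_mat :: "real^4^4 \<Rightarrow> bool" where
  "int_mat U \<longleftrightarrow> (\<forall>i j. U $ i $ j \<in> \<int>)"

definition kq :: "real^4 \<Rightarrow> real" where
  "kq x = x \<bullet> (Kmat *v x)"

lemma kq_eq: "kq x = 2 * (\<Sum>i\<in>UNIV. (x $ i)\<^sup>2) - (\<Sum>i\<in>UNIV. x $ i)\<^sup>2"
  by (simp add: kq_def Kmat_def matrix_vector_mult_def inner_vec_def sum_4)
    (simp add: power2_eq_square algebra_simps)

text \<open>In the square of 2 I - J the terms with J cancel because J J = 4 J. Hence a quarter of
  \<open>Kmat\<close> inverts \<open>Kmat\<close>.\<close>

lemma Kmat_square: "Kmat ** Kmat = 4 *\<^sub>R mat 1"
  by (simp add: vec_eq_iff forall_4 Kmat_def matrix_matrix_mult_def sum_4 mat_def)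

lemma scaleR_matrix_mult: "(a *\<^sub>R A) ** (B::real^'n^'m) = a *\<^sub>R (A ** B)"
  by (simp add: vec_eq_iff matrix_matrix_mult_def sum_distrib_left mult_ac)

lemma matrix_mult_scaleR: "A ** (a *\<^sub>R (B::real^'n^'m)) = a *\<^sub>R (A ** B)"
  by (simp add: vec_eq_iff matrix_matrix_mult_def sum_distrib_left mult_ac)

text \<open>A quarter of K U^T K is a right inverse of \<open>U\<close>, hence also a left inverse.
  This moves invariance from rows to columns, the form that \<open>kq_isoK\<close> needs.\<close>

lemma isoK_transpose:
  assumes "isoK U"
  shows "transpose U ** Kmat ** U = Kmat"
proof -
  let ?V = "(1/4) *\<^sub>R (Kmat ** transpose U ** Kmat)"
  have "U ** ?V = (1/4) *\<^sub>R ((U ** Kmat ** transpose U) ** Kmat)"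
    by (simp add: matrix_mult_scaleR matrix_mul_assoc)
  also have "\<dots> = mat 1" using assms by (simp add: isoK_def Kmat_square)
  finally have "?V ** U = mat 1" by (simp add: matrix_left_right_inverse)
  then have "Kmat ** (?V ** U) = Kmat" by simp
  moreover have "Kmat ** (?V ** U) = (1/4) *\<^sub>R ((Kmat ** Kmat) ** (transpose U ** Kmat ** U))"
    by (simp add: matrix_mult_scaleR scaleR_matrix_mult matrix_mul_assoc)
  ultimately show ?thesis by (simp add: Kmat_square scaleR_matrix_mult)
qed

lemma kq_isoK:
  assumes "isoK U"
  shows "kq (U *v x) = kq x"
proof -
  have "kq (U *v x) = (x v* transpose U) \<bullet> (Kmat *v (U *v x))"
    by (simp add: kq_def)
  also have "\<dots> = x \<bullet> ((transpose U ** Kmat ** U) *v x)"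
    by (simp only: dot_lmul_matrix matrix_vector_mul_assoc matrix_mul_assoc)
  finally show ?thesis using isoK_transpose[OF assms] by (simp add: kq_def)
qed

lemma isoK_mult: "isoK A \<Longrightarrow> isoK B \<Longrightarrow> isoK (A ** B)"
  by (simp add: isoK_def matrix_transpose_mul)
    (metis (no_types, lifting) matrix_mul_assoc)

lemma isoK_minus: "isoK A \<Longrightarrow> isoK (- A)"
  by (simp add: isoK_def vec_eq_iff matrix_matrix_mult_def transpose_def sum_negf)

section \<open>The generators and the group they generate\<close>

lemma Smat_mult:
  "(Smat i ** U) $ r $ c = U $ r $ c + (if r = i then 2 * (\<Sum>k\<in>UNIV. U $ k $ c) - 4 * U $ i $ c else 0)"
  using exhaust_4[of i] exhaust_4[of r]
  by (auto simp: Smat_def matrix_matrix_mult_def sum_4)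

text \<open>On the rows of a configuration this is inversion in circle \<open>i\<close>. Here and in
  \<open>Smat_mult\<close> the result is written as the old entry plus an even correction, ready for
  reduction modulo 2.\<close>

lemma Smat_T_mult:
  "(transpose (Smat i) ** U) $ r $ c = U $ r $ c + (if r = i then - 2 * U $ i $ c else 2 * U $ i $ c)"
  using exhaust_4[of i] exhaust_4[of r]
  by (auto simp: Smat_def matrix_matrix_mult_def sum_4 transpose_def)

lemma Smat_mult_vec:
  "(Smat i *v x) $ r = x $ r + (if r = i then 2 * (\<Sum>k\<in>UNIV. x $ k) - 4 * x $ i else 0)"
  using exhaust_4[of i] exhaust_4[of r]
  by (auto simp: Smat_def matrix_vector_mult_def sum_4)

lemma Smat_T_mult_vec:
  "(x v* Smat i) $ r = x $ r + (if r = i then - 2 * x $ i else 2 * x $ i)"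
  using exhaust_4[of i] exhaust_4[of r]
  by (auto simp: Smat_def vector_matrix_mult_def sum_4)

lemma Smat_Smat [simp]: "Smat i ** Smat i = mat 1"
  using exhaust_4[of i]
  by (auto simp: Smat_def vec_eq_iff forall_4 matrix_matrix_mult_def sum_4 mat_def)

lemma Smat_T_Smat_T [simp]: "transpose (Smat i) ** transpose (Smat i) = mat 1"
  by (metis Smat_Smat matrix_transpose_mul transpose_mat)

lemma matrix_inv_unique_square:
  fixes A :: "real^'n^'n"
  assumes "A ** A = mat 1"
  shows "matrix_inv A = A"
proof -
  have "A ** matrix_inv A = mat 1"
    unfolding matrix_inv_def by (rule conjunct1, rule someI[of _ A]) (simp add: assms)
  then have "A ** (A ** matrix_inv A) = A" by simp
  then show ?thesis by (simp add: matrix_mul_assoc assms)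
qed

lemma matrix_inv_Smat [simp]: "matrix_inv (Smat i) = Smat i"
  by (simp add: matrix_inv_unique_square)

lemma matrix_inv_Smat_T [simp]: "matrix_inv (transpose (Smat i)) = transpose (Smat i)"
  by (simp add: matrix_inv_unique_square)

lemma isoK_Smat: "isoK (Smat i)"
  using exhaust_4[of i]
  by (auto simp: isoK_def Smat_def Kmat_def vec_eq_iff forall_4 matrix_matrix_mult_def sum_4 transpose_def)

lemma isoK_Smat_T: "isoK (transpose (Smat i))"
  using exhaust_4[of i]
  by (auto simp: isoK_def Smat_def Kmat_def vec_eq_iff forall_4 matrix_matrix_mult_def sum_4 transpose_def)

text \<open>The generators are involutions, so the clauses of \<open>superA\<close> for inverses
  repeat the other two.\<close>

lemma superA_induct [consumes 1, case_names one S T]: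
  assumes "V \<in> superA" "P (mat 1)"
    "\<And>U i. U \<in> superA \<Longrightarrow> P U \<Longrightarrow> P (Smat i ** U)"
    "\<And>U i. U \<in> superA \<Longrightarrow> P U \<Longrightarrow> P (transpose (Smat i) ** U)"
  shows "P V"
  using assms(1)
  by induction (auto intro: assms simp: matrix_inv_Smat matrix_inv_Smat_T)

lemma superA_mult: "A \<in> superA \<Longrightarrow> B \<in> superA \<Longrightarrow> A ** B \<in> superA"
  by (induction A rule: superA_induct)
    (auto simp flip: matrix_mul_assoc intro: superA.intros)

lemma Smat_in: "Smat i \<in> superA" "transpose (Smat i) \<in> superA"
  using superA.gen[OF superA.one, of i] superA.genT[OF superA.one, of i] by simp_all

lemma superA_inverse: "A \<in> superA \<Longrightarrow> \<exists>B\<in>superA. B ** A = mat 1"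
proof (induction A rule: superA_induct)
  case one
  then show ?case using superA.one by force
next
  case (S U i)
  then obtain B where B: "B \<in> superA" "B ** U = mat 1" by blast
  have "(B ** Smat i) ** (Smat i ** U) = B ** (Smat i ** Smat i) ** U"
    by (simp only: matrix_mul_assoc)
  then show ?case using B superA_mult[OF B(1) Smat_in(1)[of i]] by (metis Smat_Smat matrix_mul_rid)
next
  case (T U i)
  then obtain B where B: "B \<in> superA" "B ** U = mat 1" by blast
  have "(B ** transpose (Smat i)) ** (transpose (Smat i) ** U)
      = B ** (transpose (Smat i) ** transpose (Smat i)) ** U"
    by (simp only: matrix_mul_assoc)
  then show ?case using B superA_mult[OF B(1) Smat_in(2)[of i]]
    by (metis Smat_T_Smat_T matrix_mul_rid)
qed

section \<open>Invariants of the group: residue modulo 2, the form, time orientation\<close>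

lemma Ints_even_add:
  assumes "(a - c) / 2 \<in> \<int>" "b \<in> \<int>"
  shows "(a + 2 * b - c) / (2::real) \<in> \<int>"
proof -
  have "(a + 2 * b - c) / 2 = (a - c) / 2 + b" by (simp add: field_simps)
  then show ?thesis using assms by (simp only: Ints_add)
qed

text \<open>Every generator is the identity modulo 2, and products inherit this. It later separates
  the 24 permutations.\<close>

lemma superA_int_mat_mod2:
  "V \<in> superA \<Longrightarrow> int_mat V \<and> (\<forall>i j. (V $ i $ j - mat 1 $ i $ j) / 2 \<in> \<int>)"
proof (induction V rule: superA_induct)
  case one
  then show ?case by (auto simp: int_mat_def mat_def)
next
  case (S U i)
  define b where "b r c = (if r = i then (\<Sum>k\<in>UNIV. U $ k $ c) - 2 * U $ i $ c else 0)" for r c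
  have *: "(Smat i ** U) $ r $ c = U $ r $ c + 2 * b r c" for r c
    by (simp add: Smat_mult b_def)
  have "b r c \<in> \<int>" for r c
    using S by (auto simp: b_def int_mat_def)
  then show ?case using S by (auto simp: int_mat_def * intro: Ints_even_add)
next
  case (T U i)
  define b where "b r c = (if r = i then - U $ i $ c else U $ i $ c)" for r c
  have *: "(transpose (Smat i) ** U) $ r $ c = U $ r $ c + 2 * b r c" for r c
    by (simp add: Smat_T_mult b_def)
  have "b r c \<in> \<int>" for r c
    using T by (auto simp: b_def int_mat_def)
  then show ?case using T by (auto simp: int_mat_def * intro: Ints_even_add)
qed

lemma superA_isoK: "V \<in> superA \<Longrightarrow> isoK V"
  by (induction V rule: superA_induct)
    (auto simp: isoK_mult isoK_Smat isoK_Smat_T, simp add: isoK_def)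

text \<open>By Cauchy-Schwarz on the other three entries, an entry x of a vector with entry sum s
  satisfies 8 x^2 - 4 s x - s^2 < 0. The bounds mean that s + 4 x and 3 s - 4 x, the sums after a
  transposed and a plain generator, stay positive.\<close>

lemma cone_entry_bounds:
  fixes x :: "real^4"
  assumes "kq x < 0" "(\<Sum>i\<in>UNIV. x $ i) > 0"
  shows "- (\<Sum>i\<in>UNIV. x $ i) < 4 * x $ i \<and> 4 * x $ i < 3 * (\<Sum>i\<in>UNIV. x $ i)"
proof -
  have *: "- s < 4 * x \<and> 4 * x < 3 * s"
    if q: "2 * (x\<^sup>2 + a\<^sup>2 + b\<^sup>2 + c\<^sup>2) < s\<^sup>2" and s: "s > 0" "s = x + a + b + c" for x a b c s :: real
  proof -
    have "(a + b + c)\<^sup>2 + (a - b)\<^sup>2 + (a - c)\<^sup>2 + (b - c)\<^sup>2 = 3 * (a\<^sup>2 + b\<^sup>2 + c\<^sup>2)"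
      by (simp add: power2_eq_square algebra_simps)
    then have "(a + b + c)\<^sup>2 \<le> 3 * (a\<^sup>2 + b\<^sup>2 + c\<^sup>2)"
      using zero_le_power2[of "a - b"] zero_le_power2[of "a - c"] zero_le_power2[of "b - c"] by linarith
    moreover have "a + b + c = s - x" using s by simp
    ultimately have "(s - x)\<^sup>2 \<le> 3 * (a\<^sup>2 + b\<^sup>2 + c\<^sup>2)" by simp
    moreover define P Q R where "P = (s - x)\<^sup>2" and "Q = a\<^sup>2 + b\<^sup>2 + c\<^sup>2" and "R = s\<^sup>2"
    moreover have "2 * (x\<^sup>2 + Q) < R" using q by (simp add: Q_def R_def add.assoc)
    ultimately have "2 * P < 3 * R - 6 * x\<^sup>2" by simp
    then have m: "8 * x\<^sup>2 - 4 * s * x - s\<^sup>2 < 0"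
      by (simp add: P_def R_def power2_eq_square algebra_simps)
    \<comment> \<open>The roots (1 - sqrt 3) s/4 and (1 + sqrt 3) s/4 lie strictly between -s/4 and
      3 s/4; at or beyond either bound the quadratic is at least s^2/2.\<close>
    show ?thesis
    proof (intro conjI; rule ccontr)
      assume "\<not> - s < 4 * x"
      then obtain y where "y \<ge> 0" "x = - s / 4 - y"
        by (intro that[of "- s / 4 - x"]) auto
      moreover have "8 * (- s / 4 - y)\<^sup>2 - 4 * s * (- s / 4 - y) - s\<^sup>2 = s\<^sup>2 / 2 + 8 * (s * y) + 8 * y\<^sup>2"
        by (simp add: power2_eq_square field_simps)
      ultimately show False using m s by (smt (verit) mult_nonneg_nonneg zero_le_power2 divide_nonneg_pos)
    next
      assume "\<not> 4 * x < 3 * s"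
      then obtain y where "y \<ge> 0" "x = 3 * s / 4 + y"
        by (intro that[of "x - 3 * s / 4"]) auto
      moreover have "8 * (3 * s / 4 + y)\<^sup>2 - 4 * s * (3 * s / 4 + y) - s\<^sup>2 = s\<^sup>2 / 2 + 8 * (s * y) + 8 * y\<^sup>2"
        by (simp add: power2_eq_square field_simps)
      ultimately show False using m s by (smt (verit) mult_nonneg_nonneg zero_le_power2 divide_nonneg_pos)
    qed
  qed
  show ?thesis
    using exhaust_4[of i] assms
      *[of "x$1" "x$2" "x$3" "x$4"] *[of "x$2" "x$1" "x$3" "x$4"]
      *[of "x$3" "x$1" "x$2" "x$4"] *[of "x$4" "x$1" "x$2" "x$3"]
    by (auto simp: kq_eq sum_4 add.commute add.left_commute)
qed

lemma sum_Smat: "(\<Sum>r\<in>UNIV. (Smat i *v x) $ r) = 3 * (\<Sum>r\<in>UNIV. x $ r) - 4 * x $ i"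
  using exhaust_4[of i] by (auto simp: Smat_mult_vec sum_4)

lemma sum_Smat_T: "(\<Sum>r\<in>UNIV. (x v* Smat i) $ r) = (\<Sum>r\<in>UNIV. x $ r) + 4 * x $ i"
  using exhaust_4[of i] by (auto simp: Smat_T_mult_vec sum_4)

text \<open>The sign of the entry sum is the time orientation. As \<open>kq\<close> is invariant,
  every intermediate vector stays in the cone where \<open>cone_entry_bounds\<close>
  applies.\<close>

lemma superA_cone:
  assumes "V \<in> superA" "kq x < 0" "(\<Sum>i\<in>UNIV. x $ i) > 0"
  shows "(\<Sum>i\<in>UNIV. (V *v x) $ i) > 0"
  using assms(1)
proof (induction V rule: superA_induct)
  case one
  then show ?case using assms by simp
next
  case (S U i)
  have "kq (U *v x) < 0" using assms S by (simp add: kq_isoK superA_isoK)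
  from cone_entry_bounds[OF this S(2), of i]
  show ?case by (simp add: sum_Smat flip: matrix_vector_mul_assoc)
next
  case (T U i)
  have "kq (U *v x) < 0" using assms T by (simp add: kq_isoK superA_isoK)
  from cone_entry_bounds[OF this T(2), of i]
  show ?case by (simp add: sum_Smat_T flip: matrix_vector_mul_assoc)
qed

section \<open>Descent of integral isometries to permutation matrices\<close>

definition perm_mat :: "(4 \<Rightarrow> 4) \<Rightarrow> real^4^4" where
  "perm_mat p = (\<chi> i j. if j = p i then 1 else 0)"

lemma perm_mat_mult: "(perm_mat p ** A) $ i $ j = A $ p i $ j"
  by (simp add: perm_mat_def matrix_matrix_mult_def if_distrib[of "\<lambda>x. x * _"] sum.delta cong: if_cong)

lemma isoK_rows:
  assumes "isoK U"
  shows "2 * (\<Sum>k\<in>UNIV. U $ i $ k * U $ j $ k) - (\<Sum>k\<in>UNIV. U $ i $ k) * (\<Sum>k\<in>UNIV. U $ j $ k)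
    = (if i = j then 1 else -1)"
proof -
  have "(U ** Kmat ** transpose U) $ i $ j = Kmat $ i $ j" using assms by (simp add: isoK_def)
  then show ?thesis
    by (simp add: Kmat_def matrix_matrix_mult_def transpose_def sum_4 algebra_simps split: if_splits)
qed

text \<open>With \<open>m = s/2\<close> the hypotheses give \<open>\<Sum>\<^sub>i x\<^sub>i (m - x\<^sub>i) = 4\<close>, where \<open>m\<close> is even
  by a computation modulo \<open>8\<close>, so that each of the four summands is a product of positive odd numbers.\<close>
lemma reduced_all_one:
  fixes a b c d s :: int
  assumes s: "s = a + b + c + d" and q: "2 * (a\<^sup>2 + b\<^sup>2 + c\<^sup>2 + d\<^sup>2) + 8 = s\<^sup>2"
    and odd: "odd a" "odd b" "odd c" "odd d"
    and bd: "0 \<le> a" "0 \<le> b" "0 \<le> c" "0 \<le> d" "2 * a \<le> s" "2 * b \<le> s" "2 * c \<le> s" "2 * d \<le> s"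
  shows "a = 1 \<and> b = 1 \<and> c = 1 \<and> d = 1"
proof -
  have "even s" using s odd by simp
  then obtain m where m: "s = 2 * m" by (elim evenE)
  obtain a' b' c' d' where ab: "a = 2 * a' + 1" "b = 2 * b' + 1" "c = 2 * c' + 1" "d = 2 * d' + 1"
    using odd by (meson oddE)
  have "m\<^sup>2 = 2 * (a'\<^sup>2 + a' + b'\<^sup>2 + b' + c'\<^sup>2 + c' + d'\<^sup>2 + d') + 4"
    using q unfolding m ab by (simp add: power2_eq_square algebra_simps)
  then have "even (m\<^sup>2)" by simp
  then have "even m" by simp
  have sum4: "a * (m - a) + b * (m - b) + c * (m - c) + d * (m - d) = 4"
  proof -
    define Q where "Q = a\<^sup>2 + b\<^sup>2 + c\<^sup>2 + d\<^sup>2"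
    have "a * (m - a) + b * (m - b) + c * (m - c) + d * (m - d) = m * s - Q"
      by (simp add: s Q_def power2_eq_square algebra_simps)
    moreover have "2 * (m * s) = 2 * Q + 8" using q by (simp add: Q_def m power2_eq_square)
    ultimately show ?thesis by linarith
  qed
  have pos: "0 < x" "1 \<le> x * (m - x)" if "odd x" "0 \<le> x" "2 * x \<le> s" for x
  proof -
    show "0 < x" using that by (cases "x = 0") auto
    moreover have "x \<noteq> m" using that \<open>even m\<close> by blast
    then have "0 < m - x" using that m by simp
    ultimately have "0 < x * (m - x)" by (rule mult_pos_pos)
    then show "1 \<le> x * (m - x)" by simp
  qed
  have "a * (m - a) = 1" "b * (m - b) = 1" "c * (m - c) = 1" "d * (m - d) = 1"
    using sum4 pos(2)[of a] pos(2)[of b] pos(2)[of c] pos(2)[of d] odd bd by linarith+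
  then show ?thesis
    using pos(1)[of a] pos(1)[of b] pos(1)[of c] pos(1)[of d] odd bd
    by (simp add: pos_zmult_eq_1_iff)
qed

text \<open>An integer is at most its square; equal sums therefore force each entry to equal its
  square, so to be 0 or 1.\<close>

lemma unit_int_row:
  fixes a b c d :: int
  assumes "a + b + c + d = 1" "a\<^sup>2 + b\<^sup>2 + c\<^sup>2 + d\<^sup>2 = 1"
  shows "(a = 1 \<and> b = 0 \<and> c = 0 \<and> d = 0) \<or> (a = 0 \<and> b = 1 \<and> c = 0 \<and> d = 0) \<or>
    (a = 0 \<and> b = 0 \<and> c = 1 \<and> d = 0) \<or> (a = 0 \<and> b = 0 \<and> c = 0 \<and> d = 1)"
proof -
  have "x \<le> x\<^sup>2" for x :: int
  proof -
    have "0 \<le> x * (x - 1)" by (cases "x \<le> 0") (auto intro: mult_nonpos_nonpos)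
    then show ?thesis by (simp add: power2_eq_square algebra_simps)
  qed
  then have le: "a \<le> a\<^sup>2" "b \<le> b\<^sup>2" "c \<le> c\<^sup>2" "d \<le> d\<^sup>2" by auto
  then have eq: "a\<^sup>2 = a" "b\<^sup>2 = b" "c\<^sup>2 = c" "d\<^sup>2 = d" using assms by linarith+
  then have "a \<in> {0,1}" "b \<in> {0,1}" "c \<in> {0,1}" "d \<in> {0,1}"
    by (auto simp: power2_eq_square)
  then show ?thesis using assms(1) by auto
qed

text \<open>Used with \<open>x\<close> the sum and \<open>y\<close> the sum of squares of a row: the
  norm identity makes row sums odd.\<close>

lemma Ints_odd:
  assumes "x \<in> \<int>" "y \<in> \<int>" "2 * y - x\<^sup>2 = (1::real)"
  obtains k where "x = of_int k" "odd k"
proof -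
  obtain k l where k: "x = of_int k" "y = of_int l" using assms by (auto elim!: Ints_cases)
  then have "real_of_int (2 * l - k\<^sup>2) = of_int 1" using assms(3) by simp
  then have "2 * l - k\<^sup>2 = 1" by (simp only: of_int_eq_iff)
  then have "k\<^sup>2 = 2 * (l - 1) + 1" by simp
  then have "odd (k\<^sup>2)" by simp
  then show thesis using that k by simp
qed

text \<open>Here \<open>1\<close> is the all-ones vector, so this adds up all entries. Passing
  through the vector \<open>U *v 1\<close> of row sums makes \<open>kq\<close> and the cone bounds
  available.\<close>

definition total :: "real^4^4 \<Rightarrow> real" where
  "total U = (\<Sum>i\<in>UNIV. (U *v 1) $ i)"

lemma kq_one: "kq 1 = -8"
  by (simp add: kq_eq sum_4)

text \<open>The vector of row sums has \<open>kq\<close>-value -8, but \<open>kq\<close> is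
  nonnegative on vectors with entry sum 0.\<close>

lemma isoK_total_nonzero: "isoK U \<Longrightarrow> total U \<noteq> 0"
proof
  assume "isoK U" "total U = 0"
  then have "2 * (\<Sum>i\<in>UNIV. ((U *v 1) $ i)\<^sup>2) = -8"
    using kq_isoK[of U 1] by (simp add: kq_eq kq_one total_def)
  moreover have "(\<Sum>i\<in>UNIV. ((U *v 1) $ i)\<^sup>2) \<ge> 0" by (simp add: sum_nonneg)
  ultimately show False by simp
qed

lemma mult_one_nth: "(U *v 1) $ i = (\<Sum>k\<in>UNIV. (U::real^4^4) $ i $ k)"
  by (simp add: matrix_vector_mult_def)

text \<open>The bounds \<open>red\<close> say that no generator lowers the total: with x the row sum
  at \<open>i\<close>, the transposed one changes it by 4 x, the plain one by 2
  \<open>total U\<close> - 4 x.\<close>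

lemma isoK_reduced_perm:
  assumes "isoK U" "int_mat U" "total U > 0"
    and red: "\<And>i. 0 \<le> (U *v 1) $ i \<and> 2 * (U *v 1) $ i \<le> total U"
  shows "\<exists>p. p permutes UNIV \<and> U = perm_mat p"
proof -
  have "\<exists>k. (U *v 1) $ i = of_int k \<and> odd k" for i
  proof -
    have "(U *v 1) $ i \<in> \<int>" "(\<Sum>k\<in>UNIV. U $ i $ k * U $ i $ k) \<in> \<int>"
      using assms(2) by (auto simp: mult_one_nth int_mat_def)
    moreover have "2 * (\<Sum>k\<in>UNIV. U $ i $ k * U $ i $ k) - ((U *v 1) $ i)\<^sup>2 = 1"
      using isoK_rows[OF assms(1), of i i] by (simp add: mult_one_nth power2_eq_square)
    ultimately show ?thesis by (metis Ints_odd)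
  qed
  then obtain k where k: "\<And>i. (U *v 1) $ i = of_int (k i)" "\<And>i. odd (k i)" by metis
  define s where "s = k 1 + k 2 + k 3 + k 4"
  have tot: "total U = of_int s" by (simp add: total_def k s_def sum_4)
  have "kq (U *v 1) = -8" using kq_isoK[OF assms(1)] kq_one by simp
  then have "real_of_int (2 * ((k 1)\<^sup>2 + (k 2)\<^sup>2 + (k 3)\<^sup>2 + (k 4)\<^sup>2) + 8) = of_int (s\<^sup>2)"
    by (simp add: kq_eq sum_4 k s_def)
  then have q: "2 * ((k 1)\<^sup>2 + (k 2)\<^sup>2 + (k 3)\<^sup>2 + (k 4)\<^sup>2) + 8 = s\<^sup>2" by (simp only: of_int_eq_iff)
  have bd: "0 \<le> k i" "2 * k i \<le> s" for i
  proof -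
    have "real_of_int (2 * k i) \<le> of_int s" "0 \<le> k i" using red[of i] k tot by simp_all
    then show "0 \<le> k i" "2 * k i \<le> s" by (simp_all only: of_int_le_iff)
  qed
  have "k 1 = 1 \<and> k 2 = 1 \<and> k 3 = 1 \<and> k 4 = 1"
    by (rule reduced_all_one[OF s_def q]) (rule k(2) bd)+
  then have one: "(\<Sum>j\<in>UNIV. U $ i $ j) = 1" for i
    using k(1)[of i] exhaust_4[of i] by (auto simp: mult_one_nth)
  \<comment> \<open>With row sum 1, the norm identity leaves 1 for the sum of squares, so each row
    is a unit vector.\<close>
  have "\<exists>p. \<forall>j. U $ i $ j = (if j = p then 1 else 0)" for i
  proof -
    have "\<forall>j. \<exists>a. U $ i $ j = of_int a"
      using assms(2) by (simp add: int_mat_def) (meson Ints_cases)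
    from choice[OF this] obtain a where a: "\<And>j. U $ i $ j = of_int (a j)" by blast
    have "real_of_int (a 1 + a 2 + a 3 + a 4) = of_int 1"
      using one[of i] by (simp add: a sum_4)
    moreover have "real_of_int ((a 1)\<^sup>2 + (a 2)\<^sup>2 + (a 3)\<^sup>2 + (a 4)\<^sup>2) = of_int 1"
      using isoK_rows[OF assms(1), of i i] one[of i] by (simp add: a sum_4 power2_eq_square)
    ultimately have "a 1 + a 2 + a 3 + a 4 = 1" "(a 1)\<^sup>2 + (a 2)\<^sup>2 + (a 3)\<^sup>2 + (a 4)\<^sup>2 = 1"
      by (simp_all only: of_int_eq_iff)
    from unit_int_row[OF this] show ?thesis
      by (elim disjE) (rule exI[of _ 1] exI[of _ 2] exI[of _ 3] exI[of _ 4], simp add: forall_4 a)+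
  qed
  then obtain p where p: "\<And>i j. U $ i $ j = (if j = p i then 1 else 0)" by metis
  \<comment> \<open>Equal rows at different places would have product 1 where -1 is
    required.\<close>
  have "inj p"
  proof (rule injI, rule ccontr)
    fix i j assume "p i = p j" "i \<noteq> j"
    then have "U $ i = U $ j" by (simp add: vec_eq_iff p)
    then show False using isoK_rows[OF assms(1), of i i] isoK_rows[OF assms(1), of i j] \<open>i \<noteq> j\<close> by simp
  qed
  then have "p permutes UNIV" by (intro bij_imp_permutes) (auto simp: bij_def finite_UNIV_inj_surj)
  moreover have "U = perm_mat p" by (simp add: vec_eq_iff perm_mat_def p)
  ultimately show ?thesis by blast
qed

lemma int_mat_total:
  assumes "int_mat U" shows "total U \<in> \<int>"
  using assms by (auto simp: total_def mult_one_nth int_mat_def intro!: Ints_sum)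

lemma int_mat_mult: "int_mat A \<Longrightarrow> int_mat B \<Longrightarrow> int_mat (A ** B)"
  by (auto simp: int_mat_def matrix_matrix_mult_def intro!: Ints_sum)

text \<open>Descent on the total, a positive integer: unless the matrix is reduced, some generator
  lowers the total while \<open>cone_entry_bounds\<close> keeps it positive. Being an involution,
  that generator can be moved to the other side.\<close>

lemma isoK_decompose_pos:
  assumes "isoK U" "int_mat U" "total U > 0"
  shows "\<exists>V\<in>superA. \<exists>p. p permutes UNIV \<and> U = V ** perm_mat p"
  using assms
proof (induction "nat \<lfloor>total U\<rfloor>" arbitrary: U rule: less_induct)
  case less
  show ?case
  proof (cases "\<forall>i. 0 \<le> (U *v 1) $ i \<and> 2 * (U *v 1) $ i \<le> total U")
    case True
    then obtain p where "p permutes UNIV" "U = perm_mat p" using isoK_reduced_perm less.prems by blast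
    then show ?thesis using superA.one by force
  next
    case False
    then obtain i where i: "(U *v 1) $ i < 0 \<or> 2 * (U *v 1) $ i > total U" by (auto simp: not_le)
    have "kq (U *v 1) < 0" using kq_isoK[OF less.prems(1)] kq_one by simp
    from cone_entry_bounds[OF this] less.prems(3)
    have bd: "- total U < 4 * (U *v 1) $ i" "4 * (U *v 1) $ i < 3 * total U" by (auto simp: total_def)
    \<comment> \<open>A transposed generator lowers the total when the row sum is negative, a plain
      one when the row sum exceeds half the total.\<close>
    obtain S where S: "S \<in> superA" "S ** S = mat 1" "0 < total (S ** U)" "total (S ** U) < total U"
    proof (cases "(U *v 1) $ i < 0")
      case True
      have "total (transpose (Smat i) ** U) = total U + 4 * (U *v 1) $ i"
        by (simp add: total_def sum_Smat_T flip: matrix_vector_mul_assoc)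
      then show thesis using that[of "transpose (Smat i)"] True bd Smat_in by simp
    next
      case False
      have "total (Smat i ** U) = 3 * total U - 4 * (U *v 1) $ i"
        by (simp add: total_def sum_Smat flip: matrix_vector_mul_assoc)
      then show thesis using that[of "Smat i"] False i bd Smat_in by simp
    qed
    have iso: "isoK (S ** U)" and int: "int_mat (S ** U)"
      using S(1) less.prems superA_isoK superA_int_mat_mod2 by (auto intro: isoK_mult int_mat_mult)
    have "nat \<lfloor>total (S ** U)\<rfloor> < nat \<lfloor>total U\<rfloor>"
      using int_mat_total[OF int] int_mat_total[OF less.prems(2)] S(3,4)
      by (auto elim!: Ints_cases)
    from less.hyps[OF this iso int S(3)] obtain V p where
      V: "V \<in> superA" "p permutes UNIV" "S ** U = V ** perm_mat p" by blast
    have "U = S ** (S ** U)" by (simp add: matrix_mul_assoc S(2))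
    then have "U = (S ** V) ** perm_mat p" by (simp add: V matrix_mul_assoc)
    then show ?thesis using V superA_mult[OF S(1)] by blast
  qed
qed

lemma isoK_decompose:
  assumes "isoK U" "int_mat U"
  shows "\<exists>V\<in>superA. \<exists>p. p permutes UNIV \<and> (U = V ** perm_mat p \<or> U = - (V ** perm_mat p))"
proof (cases "total U > 0")
  case True
  then show ?thesis using isoK_decompose_pos assms by blast
next
  case False
  have "total (- U) = - total U" by (simp add: total_def matrix_vector_mult_def sum_negf)
  then have "total (- U) > 0" using False isoK_total_nonzero[OF assms(1)] by simp
  moreover have "int_mat (- U)" using assms(2) by (simp add: int_mat_def)
  ultimately obtain V p where "V \<in> superA" "p permutes UNIV" "- U = V ** perm_mat p"
    using isoK_decompose_pos isoK_minus[OF assms(1)] by blast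
  then show ?thesis by (metis minus_minus)
qed

text \<open>The permutation is read off modulo \<open>2\<close>, the sign from the time orientation.\<close>
lemma superA_perm_mat:
  assumes "perm_mat p \<in> superA" shows "p = id"
proof
  fix i
  have "(perm_mat p $ i $ p i - mat 1 $ i $ p i) / 2 \<in> \<int>" using superA_int_mat_mod2[OF assms] by blast
  then show "p i = id i" by (auto simp: perm_mat_def mat_def split: if_splits)
qed

lemma superA_perm_mat_minus: "- perm_mat p \<notin> superA"
proof
  assume "- perm_mat p \<in> superA"
  from superA_cone[OF this, of 1] have "0 < (\<Sum>i\<in>UNIV. (- perm_mat p *v 1) $ i)"
    by (simp add: kq_one sum_4)
  moreover have "(- perm_mat p *v 1) $ i = -1" for i
    by (simp add: perm_mat_def mult_one_nth sum_negf)
  ultimately show False by simp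
qed

section \<open>Permutation matrices normalise the group\<close>

lemma perm_mat_comp: "perm_mat p ** perm_mat q = perm_mat (q \<circ> p)"
  unfolding vec_eq_iff perm_mat_mult by (simp add: perm_mat_def)

lemma perm_mat_id [simp]: "perm_mat id = mat 1"
  by (auto simp: vec_eq_iff perm_mat_def mat_def)

lemma perm_mat_inv: "p permutes UNIV \<Longrightarrow> perm_mat (inv p) ** perm_mat p = mat 1"
  "p permutes UNIV \<Longrightarrow> perm_mat p ** perm_mat (inv p) = mat 1"
  by (simp_all add: perm_mat_comp permutes_inv_o)

lemma mult_perm_mat:
  assumes "p permutes UNIV"
  shows "(A ** perm_mat p) $ i $ j = A $ i $ inv p j"
proof -
  have "(j = p k) = (k = inv p j)" for k using permutes_inv_eq[OF assms] by metis
  then show ?thesis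
    by (simp add: perm_mat_def matrix_matrix_mult_def if_distrib[of "\<lambda>x. _ * x"] sum.delta cong: if_cong)
qed

lemma perm_conj_Smat:
  assumes "p permutes UNIV"
  shows "perm_mat p ** Smat i = Smat (inv p i) ** perm_mat p"
    "perm_mat p ** transpose (Smat i) = transpose (Smat (inv p i)) ** perm_mat p"
proof -
  have "(p r = c) = (r = inv p c)" for r c
    using permutes_inv_eq[OF assms] by metis
  moreover have "(inv p c = inv p i) = (c = i)" for c
    using permutes_inj[OF permutes_inv[OF assms]] by (simp add: inj_eq)
  ultimately show "perm_mat p ** Smat i = Smat (inv p i) ** perm_mat p"
    "perm_mat p ** transpose (Smat i) = transpose (Smat (inv p i)) ** perm_mat p"
    by (auto simp: vec_eq_iff perm_mat_mult mult_perm_mat[OF assms] Smat_def transpose_def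
        permutes_inverses[OF assms])
qed

text \<open>Conjugation renumbers the generators, so left multiplication by a permutation carries
  orbits to orbits.\<close>

lemma superA_perm_conj:
  assumes "p permutes UNIV" "V \<in> superA"
  shows "\<exists>V'\<in>superA. perm_mat p ** V = V' ** perm_mat p"
  using assms(2)
proof (induction V rule: superA_induct)
  case one
  then show ?case using superA.one by force
next
  case (S U i)
  then obtain V' where V': "V' \<in> superA" "perm_mat p ** U = V' ** perm_mat p" by blast
  have "perm_mat p ** (Smat i ** U) = Smat (inv p i) ** (perm_mat p ** U)"
    by (simp add: matrix_mul_assoc perm_conj_Smat[OF assms(1)])
  also have "\<dots> = (Smat (inv p i) ** V') ** perm_mat p"
    by (simp add: V' matrix_mul_assoc)
  finally show ?case using superA.gen[OF V'(1)] by blast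
next
  case (T U i)
  then obtain V' where V': "V' \<in> superA" "perm_mat p ** U = V' ** perm_mat p" by blast
  have "perm_mat p ** (transpose (Smat i) ** U) = transpose (Smat (inv p i)) ** (perm_mat p ** U)"
    by (simp add: matrix_mul_assoc perm_conj_Smat[OF assms(1)])
  also have "\<dots> = (transpose (Smat (inv p i)) ** V') ** perm_mat p"
    by (simp add: V' matrix_mul_assoc)
  finally show ?case using superA.genT[OF V'(1)] by blast
qed

subsection \<open>Orbits and row lattices\<close>

definition Qmat :: "real^4^4" where
  "Qmat = (\<chi> i j. if i = j then (if i = 3 \<or> i = 4 then 1 else 0)
     else if (i = 1 \<and> j = 2) \<or> (i = 2 \<and> j = 1) then - 1 / 2 else 0)"

lemma mult_Qmat: "(W ** Qmat ** transpose W) $ i $ j = bil (W $ i) (W $ j)"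
  by (simp add: Qmat_def bil_def matrix_matrix_mult_def transpose_def sum_4 field_simps)

lemma Wmat_nth: "Wmat D $ i = wrow (D i)"
  by (simp add: Wmat_def)

lemma oo_descartes_gram:
  assumes "oo_descartes D"
  shows "Wmat D ** Qmat ** transpose (Wmat D) = Kmat"
  unfolding vec_eq_iff mult_Qmat using oo_descartes_bil[OF assms] by (simp add: Wmat_nth Kmat_def)

text \<open>The four rows are linearly independent, since their Gram matrix \<open>Kmat\<close> is
  invertible.\<close>

lemma Wmat_cancel:
  assumes "oo_descartes D" "A ** Wmat D = B ** Wmat D"
  shows "A = B"
proof -
  have "A ** Kmat = B ** Kmat"
    using oo_descartes_gram[OF assms(1)] assms(2) by (metis matrix_mul_assoc)
  then have "A ** Kmat ** Kmat = B ** Kmat ** Kmat" by simp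
  then have "4 *\<^sub>R A = 4 *\<^sub>R B"
    by (simp add: matrix_mul_assoc[symmetric] Kmat_square matrix_mult_scaleR)
  then show ?thesis by simp
qed

lemma Wmat_isoK:
  assumes "oo_descartes D" "oo_descartes D'" "Wmat D' = U ** Wmat D"
  shows "isoK U"
proof -
  have "Kmat = (U ** Wmat D) ** Qmat ** transpose (U ** Wmat D)"
    using oo_descartes_gram[OF assms(2)] assms(3) by simp
  also have "\<dots> = U ** (Wmat D ** Qmat ** transpose (Wmat D)) ** transpose U"
    by (simp add: matrix_transpose_mul matrix_mul_assoc)
  finally show ?thesis using oo_descartes_gram[OF assms(1)] by (simp add: isoK_def)
qed

section \<open>Reordering and total reversal: the 48 versions of a configuration\<close>

definition act :: "bool \<Rightarrow> (4 \<Rightarrow> 4) \<Rightarrow> (4 \<Rightarrow> ocircle) \<Rightarrow> 4 \<Rightarrow> ocircle" where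
  "act s p D = (if s then flip_oc \<circ> D \<circ> p else D \<circ> p)"

lemma pos_descartes_perm:
  assumes "p permutes UNIV" "pos_descartes D"
  shows "pos_descartes (D \<circ> p)"
  using assms permutes_inj[OF assms(1)] by (simp add: pos_descartes_def inj_eq)

lemma oo_descartes_act:
  assumes "p permutes UNIV" "oo_descartes D"
  shows "oo_descartes (act s p D)"
proof -
  have "flip_oc \<circ> (flip_oc \<circ> D \<circ> p) = D \<circ> p" by (simp add: fun_eq_iff)
  then show ?thesis using assms pos_descartes_perm[OF assms(1)]
    by (auto simp: act_def oo_descartes_def o_assoc)
qed

lemma Wmat_act:
  assumes "oo_descartes D"
  shows "Wmat (act s p D) = (if s then - perm_mat p else perm_mat p) ** Wmat D"
proof -
  have "(perm_mat p ** Wmat D) $ i = wrow (D (p i))" for i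
    by (simp add: vec_eq_iff perm_mat_mult Wmat_nth)
  moreover have "- perm_mat p ** Wmat D = - (perm_mat p ** Wmat D)"
    by (simp add: vec_eq_iff matrix_matrix_mult_def sum_negf)
  ultimately show ?thesis
    by (simp add: vec_eq_iff[where x="Wmat _"] Wmat_nth act_def wrow_flip oo_descartes_valid[OF assms])
qed

lemma integral_act:
  assumes "integral_W D" "oo_descartes D"
  shows "integral_W (act s p D)"
  using assms by (auto simp: integral_W_def Wmat_nth act_def wrow_flip oo_descartes_valid)

lemma superA_orbit_self: "oo_descartes D \<Longrightarrow> D \<in> superA_orbit D"
  using superA.one by (force simp: superA_orbit_def)

lemma superA_orbit_eq:
  assumes "D' \<in> superA_orbit D"
  shows "superA_orbit D' = superA_orbit D"
proof -
  obtain V where V: "V \<in> superA" "Wmat D' = V ** Wmat D"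
    using assms by (auto simp: superA_orbit_def)
  obtain V' where V': "V' \<in> superA" "V' ** V = mat 1" using superA_inverse[OF V(1)] by blast
  have W: "Wmat D = V' ** Wmat D'" by (simp add: V V' matrix_mul_assoc)
  have sub: "superA_orbit E' \<subseteq> superA_orbit E" if A: "A \<in> superA" "Wmat E' = A ** Wmat E" for A E E'
  proof
    fix F assume "F \<in> superA_orbit E'"
    then obtain B where "oo_descartes F" "B \<in> superA" "Wmat F = (B ** A) ** Wmat E"
      using A(2) by (auto simp: superA_orbit_def matrix_mul_assoc)
    then show "F \<in> superA_orbit E"
      using superA_mult[OF _ A(1)] unfolding superA_orbit_def by blast
  qed
  show ?thesis using sub[OF V] sub[OF V'(1) W] by blast
qed

lemma super_packing_eq: "D' \<in> superA_orbit D \<Longrightarrow> super_packing D' = super_packing D"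
  by (simp add: super_packing_def superA_orbit_eq)

text \<open>Permutations normalise the group and the sign is central.\<close>

lemma act_orbit:
  assumes p: "p permutes UNIV" and D: "oo_descartes D" and D': "D' \<in> superA_orbit D"
  shows "act s p D' \<in> superA_orbit (act s p D)"
proof -
  obtain V where V: "V \<in> superA" "Wmat D' = V ** Wmat D" "oo_descartes D'"
    using D' by (auto simp: superA_orbit_def)
  obtain V' where V': "V' \<in> superA" "perm_mat p ** V = V' ** perm_mat p"
    using superA_perm_conj[OF p V(1)] by blast
  have neg: "- A ** B = - (A ** B)" "A ** - B = - (A ** B)" for A B :: "real^4^4"
    by (simp_all add: vec_eq_iff matrix_matrix_mult_def sum_negf)
  have "(if s then - perm_mat p else perm_mat p) ** V = V' ** (if s then - perm_mat p else perm_mat p)"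
    using V'(2) by (simp add: neg)
  then have "Wmat (act s p D') = V' ** Wmat (act s p D)"
    by (simp add: Wmat_act[OF V(3)] Wmat_act[OF D] V(2) matrix_mul_assoc)
  then show ?thesis using V' oo_descartes_act[OF p V(3)] by (auto simp: superA_orbit_def)
qed

lemma circ_sets_act:
  assumes "p permutes UNIV"
  shows "range (\<lambda>i. circ_set (act s p D i)) = range (\<lambda>i. circ_set (D i))"
proof -
  have "range (\<lambda>i. circ_set (act s p D i)) = (\<lambda>i. circ_set (D i)) ` range p"
    by (simp add: act_def image_image)
  then show ?thesis using permutes_image[OF assms] by simp
qed

lemma super_packing_act_subset:
  assumes "p permutes UNIV" "oo_descartes D"
  shows "super_packing D \<subseteq> super_packing (act s p D)"
proof
  fix S assume "S \<in> super_packing D"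
  then obtain D' where D': "D' \<in> superA_orbit D" "S \<in> range (\<lambda>i. circ_set (D' i))"
    unfolding super_packing_def by (elim UN_E)
  then have "S \<in> range (\<lambda>i. circ_set (act s p D' i))" by (simp only: circ_sets_act[OF assms(1)])
  then show "S \<in> super_packing (act s p D)"
    unfolding super_packing_def by (rule UN_I[OF act_orbit[OF assms D'(1)]])
qed

lemma super_packing_act:
  assumes p: "p permutes UNIV" and D: "oo_descartes D"
  shows "super_packing (act s p D) = super_packing D"
proof
  \<comment> \<open>The transformed configuration is carried back by an operation of the same kind,
    which gives the reverse inclusion.\<close>
  have "act s (inv p) (act s p D) = D"
    using permutes_inverses[OF p] by (auto simp: act_def fun_eq_iff)
  then show "super_packing (act s p D) \<subseteq> super_packing D"
    using super_packing_act_subset[OF permutes_inv[OF p] oo_descartes_act[OF p D], of s s] by simp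
qed (rule super_packing_act_subset[OF assms])

text \<open>Independence of the rows turns equal orbits into a matrix identity, which puts
  \<open>perm_mat (inv q \<circ> p)\<close> or its negative into \<open>superA\<close>. Time
  orientation excludes the negative, and reduction modulo 2 leaves only the identity.\<close>

lemma act_orbit_inj:
  assumes p: "p permutes UNIV" and q: "q permutes UNIV" and D: "oo_descartes D"
    and eq: "superA_orbit (act s p D) = superA_orbit (act t q D)"
  shows "s = t \<and> p = q"
proof -
  let ?c = "\<lambda>s p. if s then - perm_mat p else perm_mat p"
  have "act s p D \<in> superA_orbit (act t q D)"
    using superA_orbit_self[OF oo_descartes_act[OF p D]] eq by blast
  then obtain V where V: "V \<in> superA" "Wmat (act s p D) = V ** Wmat (act t q D)"
    by (auto simp: superA_orbit_def)
  then have "?c s p ** Wmat D = (V ** ?c t q) ** Wmat D"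
    by (simp add: Wmat_act[OF D] matrix_mul_assoc)
  then have "?c s p = V ** ?c t q" by (rule Wmat_cancel[OF D])
  then have "?c s p ** perm_mat (inv q) = V ** (?c t q ** perm_mat (inv q))"
    by (simp add: matrix_mul_assoc)
  also have neg: "- A ** B = - (A ** B)" "A ** - B = - (A ** B)" for A B :: "real^4^4"
    by (simp_all add: vec_eq_iff matrix_matrix_mult_def sum_negf)
  then have "V ** (?c t q ** perm_mat (inv q)) = (if t then - V else V)"
    by (simp add: perm_mat_inv[OF q])
  finally have "V = (if s = t then perm_mat p ** perm_mat (inv q) else - (perm_mat p ** perm_mat (inv q)))"
    by (auto simp: neg split: if_splits)
  then have V_eq: "V = (if s = t then perm_mat (inv q \<circ> p) else - perm_mat (inv q \<circ> p))"
    by (simp add: perm_mat_comp)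
  then have st: "s = t" using V(1) superA_perm_mat_minus by (auto split: if_splits)
  then have "inv q \<circ> p = id" using V(1) V_eq superA_perm_mat by simp
  then have "p = q" using permutes_inverses[OF q] by (metis (no_types) comp_assoc comp_id id_comp permutes_inv_o(1)[OF q])
  with st show ?thesis by simp
qed

section \<open>The row lattice as classifying invariant\<close>

definition row_lattice :: "(4 \<Rightarrow> ocircle) \<Rightarrow> (real^4) set" where
  "row_lattice D = {\<Sum>k\<in>UNIV. of_int (c k) *\<^sub>R wrow (D k) | c :: 4 \<Rightarrow> int. True}"

lemma row_lattice_minus: "r \<in> row_lattice D \<Longrightarrow> - r \<in> row_lattice D"
proof -
  assume "r \<in> row_lattice D"
  then obtain c :: "4 \<Rightarrow> int" where "r = (\<Sum>k\<in>UNIV. of_int (c k) *\<^sub>R wrow (D k))"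
    by (auto simp: row_lattice_def)
  then have "- r = (\<Sum>k\<in>UNIV. of_int ((\<lambda>k. - c k) k) *\<^sub>R wrow (D k))"
    by (simp add: sum_negf)
  then show ?thesis unfolding row_lattice_def by (intro CollectI exI conjI TrueI)
qed

lemma mult_Wmat_row: "(U ** Wmat D) $ i = (\<Sum>k\<in>UNIV. (U $ i $ k) *\<^sub>R wrow (D k))"
  by (simp add: vec_eq_iff matrix_matrix_mult_def Wmat_nth)

lemma orbit_row_lattice:
  assumes "D' \<in> superA_orbit D"
  shows "wrow (D' i) \<in> row_lattice D"
proof -
  obtain V where V: "V \<in> superA" "Wmat D' = V ** Wmat D"
    using assms by (auto simp: superA_orbit_def)
  have "\<forall>k. \<exists>a. V $ i $ k = of_int a"
    using superA_int_mat_mod2[OF V(1)] by (simp add: int_mat_def) (meson Ints_cases)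
  from choice[OF this] obtain c where "\<And>k. V $ i $ k = of_int (c k)" by blast
  then have "wrow (D' i) = (\<Sum>k\<in>UNIV. of_int (c k) *\<^sub>R wrow (D k))"
    using mult_Wmat_row[of V D i] V(2) by (simp flip: Wmat_nth)
  then show ?thesis unfolding row_lattice_def by blast
qed

text \<open>A circle of the packing fixes its row only up to sign; that suffices because the lattice
  is closed under negation.\<close>

lemma packing_row_lattice:
  assumes D: "oo_descartes D" and sub: "super_packing D \<subseteq> super_packing E"
  shows "wrow (D i) \<in> row_lattice E"
proof -
  have "circ_set (D i) \<in> super_packing D"
    using superA_orbit_self[OF D] by (auto simp: super_packing_def)
  with sub have "circ_set (D i) \<in> super_packing E" by (rule subsetD)
  then obtain D' j where D': "D' \<in> superA_orbit E" "circ_set (D' j) = circ_set (D i)"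
    by (auto simp: super_packing_def)
  then have v: "valid_oc (D' j)" "valid_oc (D i)"
    using D oo_descartes_valid by (auto simp: superA_orbit_def)
  from wrow_eq_of_circ_set[OF v D'(2)] have "wrow (D i) = wrow (D' j) \<or> wrow (D i) = - wrow (D' j)"
    using wrow_flip[OF v(1)] by auto
  then show ?thesis using orbit_row_lattice[OF D'(1), of j] row_lattice_minus by auto
qed

text \<open>The integer coefficients form a matrix \<open>U\<close> between two bases with the same
  Gram matrix \<open>Kmat\<close>; \<open>isoK_decompose\<close> splits it into a group element, a
  permutation and a sign.\<close>

lemma row_lattice_orbit:
  assumes D: "oo_descartes D" and D': "oo_descartes D'" and r: "\<And>i. wrow (D' i) \<in> row_lattice D"
  shows "\<exists>s p. p permutes UNIV \<and> D' \<in> superA_orbit (act s p D)"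
proof -
  have "\<forall>i. \<exists>c::4 \<Rightarrow> int. wrow (D' i) = (\<Sum>k\<in>UNIV. of_int (c k) *\<^sub>R wrow (D k))"
    using r by (auto simp: row_lattice_def)
  from choice[OF this] obtain c :: "4 \<Rightarrow> 4 \<Rightarrow> int" where
    c: "\<And>i. wrow (D' i) = (\<Sum>k\<in>UNIV. of_int (c i k) *\<^sub>R wrow (D k))" by blast
  define U :: "real^4^4" where "U = (\<chi> i k. of_int (c i k))"
  have W: "Wmat D' = U ** Wmat D"
  proof -
    have "Wmat D' $ i = (U ** Wmat D) $ i" for i
      unfolding mult_Wmat_row Wmat_nth c by (simp add: U_def)
    then show ?thesis by (simp add: vec_eq_iff)
  qed
  have "int_mat U" by (simp add: int_mat_def U_def)
  from isoK_decompose[OF Wmat_isoK[OF D D' W] this] obtain V p where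
    V: "V \<in> superA" "p permutes UNIV" "U = V ** perm_mat p \<or> U = - (V ** perm_mat p)" by blast
  have neg: "- (A ** B) = A ** - B" for A B :: "real^4^4"
    by (simp_all add: vec_eq_iff matrix_matrix_mult_def sum_negf)
  from V(3) obtain s where "U = V ** (if s then - perm_mat p else perm_mat p)"
    unfolding neg by (metis (full_types))
  then have "Wmat D' = V ** Wmat (act s p D)"
    by (simp add: W Wmat_act[OF D] matrix_mul_assoc)
  then show ?thesis using V D' by (auto simp: superA_orbit_def)
qed

text \<open>The family \<open>f\<close> picks one configuration per lattice. Each contributes one
  packing, because \<open>act\<close> preserves packings, and 2 * 4! = 48 orbits, because
  \<open>act_orbit_inj\<close> keeps them apart.\<close>

lemma orbit_count:
  fixes f :: "'i \<Rightarrow> 4 \<Rightarrow> ocircle"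
  assumes fin: "finite I"
    and rep: "\<And>i. i \<in> I \<Longrightarrow> oo_descartes (f i) \<and> integral_W (f i)"
    and cover: "\<And>D. oo_descartes D \<Longrightarrow> integral_W D \<Longrightarrow> \<exists>i\<in>I. \<forall>k. wrow (D k) \<in> row_lattice (f i)"
    and sep: "\<And>i j. i \<in> I \<Longrightarrow> j \<in> I \<Longrightarrow> \<forall>k. wrow (f i k) \<in> row_lattice (f j) \<and> wrow (f j k) \<in> row_lattice (f i) \<Longrightarrow> i = j"
  shows "card {super_packing D | D. oo_descartes D \<and> integral_W D} = card I"
    and "card {superA_orbit D | D. oo_descartes D \<and> integral_W D} = 48 * card I"
proof -
  let ?P = "{p :: 4 \<Rightarrow> 4. p permutes UNIV}"
  let ?X = "I \<times> (UNIV :: bool set) \<times> ?P"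
  let ?g = "\<lambda>(i, s, p). act s p (f i)"
  have inj: "inj_on (super_packing \<circ> f) I"
  proof (rule inj_onI)
    fix i j assume ij: "i \<in> I" "j \<in> I" "(super_packing \<circ> f) i = (super_packing \<circ> f) j"
    then show "i = j"
      using packing_row_lattice[of "f i" "f j"] packing_row_lattice[of "f j" "f i"] rep
      by (intro sep) auto
  qed
  have cov: "\<exists>i\<in>I. \<exists>s p. p permutes UNIV \<and> D \<in> superA_orbit (act s p (f i))"
    if D: "oo_descartes D" "integral_W D" for D
    using cover[OF D] row_lattice_orbit[OF _ D(1)] rep by metis
  have "{super_packing D | D. oo_descartes D \<and> integral_W D} = (super_packing \<circ> f) ` I"
  proof (intro set_eqI iffI)
    fix S assume "S \<in> {super_packing D | D. oo_descartes D \<and> integral_W D}"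
    then obtain D where D: "S = super_packing D" "oo_descartes D" "integral_W D" by blast
    obtain i s p where i: "i \<in> I" "p permutes UNIV" "D \<in> superA_orbit (act s p (f i))"
      using cov[OF D(2,3)] by blast
    then have "S = super_packing (f i)"
      using super_packing_eq super_packing_act rep D(1) by metis
    then show "S \<in> (super_packing \<circ> f) ` I" using i(1) by simp
  qed (use rep in auto)
  then show "card {super_packing D | D. oo_descartes D \<and> integral_W D} = card I"
    using card_image[OF inj] by simp
  have injg: "inj_on (superA_orbit \<circ> ?g) ?X"
  proof (rule inj_onI, clarsimp)
    fix i s p j t q
    assume i: "i \<in> I" "p permutes UNIV" and j: "j \<in> I" "q permutes UNIV"
      and eq: "superA_orbit (act s p (f i)) = superA_orbit (act t q (f j))"
    \<comment> \<open>Orbits determine packings, so equality first gives \<open>i = j\<close>; only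
      then can \<open>act_orbit_inj\<close> compare signs and permutations.\<close>
    then have "super_packing (act s p (f i)) = super_packing (act t q (f j))"
      by (simp add: super_packing_def)
    then have "super_packing (f i) = super_packing (f j)"
      using i j rep super_packing_act by simp
    then have "i = j" using inj_onD[OF inj, of i j] i j by simp
    then show "i = j \<and> s = t \<and> p = q" using act_orbit_inj[of p q "f i" s t] i j rep eq by simp
  qed
  have "{superA_orbit D | D. oo_descartes D \<and> integral_W D} = (superA_orbit \<circ> ?g) ` ?X"
  proof (intro set_eqI iffI)
    fix S assume "S \<in> {superA_orbit D | D. oo_descartes D \<and> integral_W D}"
    then obtain D where D: "S = superA_orbit D" "oo_descartes D" "integral_W D" by blast
    obtain i s p where i: "i \<in> I" "p permutes UNIV" "D \<in> superA_orbit (act s p (f i))"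
      using cov[OF D(2,3)] by blast
    then have "S = (superA_orbit \<circ> ?g) (i, s, p)"
      using superA_orbit_eq D(1) by simp
    then show "S \<in> (superA_orbit \<circ> ?g) ` ?X" using i by blast
  next
    fix S assume "S \<in> (superA_orbit \<circ> ?g) ` ?X"
    then obtain i s p where "i \<in> I" "p permutes UNIV" "S = superA_orbit (act s p (f i))" by auto
    then show "S \<in> {superA_orbit D | D. oo_descartes D \<and> integral_W D}"
      using rep oo_descartes_act integral_act by blast
  qed
  then have "card {superA_orbit D | D. oo_descartes D \<and> integral_W D} = card ?X"
    using card_image[OF injg] by simp
  also have "\<dots> = card I * (2 * fact 4)"
    using card_permutations[of "UNIV :: 4 set" 4] by (simp add: card_cartesian_product)
  also have "\<dots> = 48 * card I" by (simp add: fact_numeral)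
  finally show "card {superA_orbit D | D. oo_descartes D \<and> integral_W D} = 48 * card I" .
qed

subsection \<open>The fourteen integral lattices\<close>

type_synonym int_row = "int \<times> int \<times> int \<times> int"

text \<open>The index \<open>(sw, g, X, Y)\<close> describes two parallel lines at distance \<open>2/g\<close> and two circles of radius
  \<open>1/g\<close> between them, which touch at the point \<open>(X, Y)/g\<close>; \<open>sw\<close> exchanges the two coordinate axes.\<close>
type_synonym rep_index = "bool \<times> int \<times> int \<times> int"

fun rep :: "rep_index \<Rightarrow> 4 \<Rightarrow> ocircle" where
  "rep (sw, g, X, Y) i =
    (let t = (if sw then \<i> else 1); n = (if sw then 1 else \<i>) in
     if i = 1 then Half n ((of_int Y + 1) / of_int g)
     else if i = 2 then Half (- n) ((1 - of_int Y) / of_int g)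
     else if i = 3 then Disk (((of_int X + 1) / of_int g) *\<^sub>R t + (of_int Y / of_int g) *\<^sub>R n) (1 / of_int g)
     else Disk (((of_int X - 1) / of_int g) *\<^sub>R t + (of_int Y / of_int g) *\<^sub>R n) (1 / of_int g))"

text \<open>Four lattices with \<open>g = 1\<close>, two with \<open>g = 2\<close> and one with
  \<open>g = 4\<close>, each for both choices of axes: 2 * 7 = 14.\<close>

definition rep_indices :: "rep_index list" where
  "rep_indices = List.product [False, True]
    [(1,0,0), (1,0,1), (1,1,0), (1,1,1), (2,0,0), (2,1,1), (4,1,1)]"

section \<open>Congruence tests and the finite search\<close>

fun row_vec :: "int_row \<Rightarrow> real^4" where
  "row_vec (p, q, u, v) = vector [of_int p, of_int q, of_int u, of_int v]"

text \<open>Solvability of the linear system for integer coefficients of the rows of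
  \<open>rep\<close>: \<open>k\<close> is the sum of the two disk coefficients, the parity test
  decides whether it can be split between the disks, and the test modulo 4 yields the coefficient of
  the second line.\<close>

fun lat_mem :: "rep_index \<Rightarrow> int_row \<Rightarrow> bool" where
  "lat_mem (sw, g, X, Y) (p, q, u, v) =
    (let (x, y) = (if sw then (v, u) else (u, v)); k = q div g
     in q mod g = 0 \<and> (x - (X + 1) * k) mod 2 = 0 \<and>
       (p * g - 2 * X * x - 2 * (Y + 1) * y + (X * X + Y * Y + 2 * Y) * k) mod 4 = 0)"

text \<open>Twice the tangency condition \<open>bil = -1\<close>, read modulo 4.\<close>

fun compat :: "int_row \<Rightarrow> int_row \<Rightarrow> bool" where
  "compat (p, q, u, v) (p', q', u', v') \<longleftrightarrow>
    (2 * u * u' + 2 * v * v' - p * q' - p' * q + 2) mod 4 = 0"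

text \<open>The list \<open>rs\<close> holds the rows compatible with all those chosen so far; the search stops early at a
  candidate lattice containing all of them.\<close>
fun cliques_covered :: "nat \<Rightarrow> rep_index list \<Rightarrow> int_row list \<Rightarrow> bool" where
  "cliques_covered 0 cands rs \<longleftrightarrow> cands \<noteq> []"
| "cliques_covered (Suc n) cands rs \<longleftrightarrow> list_ex (\<lambda>i. list_all (lat_mem i) rs) cands \<or>
    list_all (\<lambda>a. cliques_covered n (filter (\<lambda>i. lat_mem i a) cands) (filter (compat a) rs)) rs"

text \<open>Norm 1 modulo 4. Parities of \<open>u\<close> and \<open>v\<close> are enough, since
  \<open>u * u\<close> and \<open>2 * u * u'\<close> modulo 4 depend only on them.\<close>

definition residue_rows :: "int_row list" where
  "residue_rows = filter (\<lambda>(p, q, u, v). (u * u + v * v - p * q - 1) mod 4 = 0)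
    (List.product [0,1,2,3] (List.product [0,1,2,3] (List.product [0,1] [0,1])))"

text \<open>Exhaustive evaluation; the numeral 4 is rewritten to successors to match the
  recursion.\<close>

lemma cliques_covered_residues: "cliques_covered 4 rep_indices residue_rows"
  unfolding residue_rows_def rep_indices_def numeral_eq_Suc pred_numeral_simps BitM.simps
  by code_simp

text \<open>Soundness of the search: choosing the head \<open>a\<close> filters both the candidates
  and the later rows, and at an early stop one candidate contains every row still available.\<close>

lemma cliques_coveredD:
  assumes "cliques_covered n cands rs" "length xs = n" "set xs \<subseteq> set rs"
    "\<And>i j. i < j \<Longrightarrow> j < n \<Longrightarrow> compat (xs ! i) (xs ! j)"
  shows "\<exists>i\<in>set cands. \<forall>x\<in>set xs. lat_mem i x"
  using assms
proof (induction n arbitrary: cands rs xs)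
  case 0
  then show ?case by (cases cands) auto
next
  case (Suc n)
  consider "list_ex (\<lambda>i. list_all (lat_mem i) rs) cands"
    | "list_all (\<lambda>a. cliques_covered n (filter (\<lambda>i. lat_mem i a) cands) (filter (compat a) rs)) rs"
    using Suc.prems(1) by auto
  then show ?case
  proof cases
    case 1
    then show ?thesis using Suc.prems(3) by (force simp: list_ex_iff list_all_iff)
  next
    case 2
    obtain a ys where xs: "xs = a # ys" "length ys = n" using Suc.prems(2) by (cases xs) auto
    have "cliques_covered n (filter (\<lambda>i. lat_mem i a) cands) (filter (compat a) rs)"
      using 2 xs Suc.prems(3) by (auto simp: list_all_iff)
    moreover have "set ys \<subseteq> set (filter (compat a) rs)"
    proof
      fix y assume "y \<in> set ys"
      then obtain j where j: "j < n" "y = ys ! j" using xs by (metis in_set_conv_nth)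
      then have "compat a y" using Suc.prems(4)[of 0 "Suc j"] xs by simp
      then show "y \<in> set (filter (compat a) rs)" using \<open>y \<in> set ys\<close> Suc.prems(3) xs by auto
    qed
    moreover have "compat (ys ! i) (ys ! j)" if "i < j" "j < n" for i j
      using Suc.prems(4)[of "Suc i" "Suc j"] that xs by simp
    ultimately have "\<exists>i\<in>set (filter (\<lambda>i. lat_mem i a) cands). \<forall>x\<in>set ys. lat_mem i x"
      using Suc.IH[OF _ xs(2)] by blast
    then show ?thesis using xs by auto
  qed
qed

section \<open>Lattice membership depends only on residues\<close>

fun residue :: "int_row \<Rightarrow> int_row" where
  "residue (p, q, u, v) = (p mod 4, q mod 4, u mod 2, v mod 2)"

text \<open>Adding \<open>4 * b\<close> to \<open>q\<close> adds \<open>h * b\<close> to the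
  quotient by \<open>g\<close>; hypotheses \<open>e\<close> and \<open>f\<close> make the induced
  changes multiples of 2 and 4, the moduli of the two tests.\<close>

lemma lat_mem_shift:
  assumes gh: "g * h = 4" "g \<noteq> 0" and e: "(X + 1) * h = 2 * e" and f: "(X * X + Y * Y + 2 * Y) * h = 4 * f"
  shows "lat_mem (sw, g, X, Y) (p + 4 * a, q + 4 * b, u + 2 * c, v + 2 * d)
    = lat_mem (sw, g, X, Y) (p, q, u, v)"
proof -
  let ?N = "X * X + Y * Y + 2 * Y"
  have q: "q + 4 * b = q + g * (h * b)" using gh by simp
  have qmod: "(q + 4 * b) mod g = q mod g" unfolding q by (rule mod_mult_self2)
  have qdiv: "(q + 4 * b) div g = q div g + h * b"
    unfolding q using gh by (simp add: add.commute)
  have 2: "(x + 2 * c - (X + 1) * (k + h * b)) mod 2 = (x - (X + 1) * k) mod 2" for x c k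
  proof -
    have "x + 2 * c - (X + 1) * (k + h * b) = (x - (X + 1) * k) + 2 * c - ((X + 1) * h) * b"
      by (simp add: algebra_simps)
    also have "\<dots> = (x - (X + 1) * k) + 2 * (c - e * b)" unfolding e by (simp add: algebra_simps)
    finally show ?thesis by (simp only: mod_mult_self2)
  qed
  have 4: "((p + 4 * a) * g - 2 * X * (x + 2 * c) - 2 * (Y + 1) * (y + 2 * d) + ?N * (k + h * b)) mod 4
      = (p * g - 2 * X * x - 2 * (Y + 1) * y + ?N * k) mod 4" for x y c d k
  proof -
    have "(p + 4 * a) * g - 2 * X * (x + 2 * c) - 2 * (Y + 1) * (y + 2 * d) + ?N * (k + h * b)
      = (p * g - 2 * X * x - 2 * (Y + 1) * y + ?N * k) + 4 * (a * g - X * c - (Y + 1) * d) + (?N * h) * b"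
      by (simp add: algebra_simps)
    also have "\<dots> = (p * g - 2 * X * x - 2 * (Y + 1) * y + ?N * k) + 4 * (a * g - X * c - (Y + 1) * d + f * b)"
      unfolding f by (simp add: algebra_simps)
    finally show ?thesis by (simp only: mod_mult_self2)
  qed
  show ?thesis by (cases sw) (simp_all only: lat_mem.simps Let_def if_True if_False prod.case qmod qdiv 2 4)
qed

lemma lat_mem_residue:
  assumes "i \<in> set rep_indices"
  shows "lat_mem i (residue r) = lat_mem i r"
proof (cases r)
  case (fields p q u v)
  obtain sw g X Y where i: "i = (sw, g, X, Y)" by (cases i)
  define h where "h = 4 div g"
  define e where "e = (X + 1) * h div 2"
  define f where "f = (X * X + Y * Y + 2 * Y) * h div 4"
  \<comment> \<open>Evaluated at each of the fourteen indices, where the divisions in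
    \<open>h\<close>, \<open>e\<close> and \<open>f\<close> are exact.\<close>
  have h: "g * h = 4" "(X + 1) * h = 2 * e" "(X * X + Y * Y + 2 * Y) * h = 4 * f"
    using assms by (auto simp: i rep_indices_def h_def e_def f_def)
  then have "g \<noteq> 0" by auto
  have r: "r = (p mod 4 + 4 * (p div 4), q mod 4 + 4 * (q div 4), u mod 2 + 2 * (u div 2), v mod 2 + 2 * (v div 2))"
    using fields by simp
  show ?thesis unfolding i fields residue.simps
    using lat_mem_shift[OF h(1) \<open>g \<noteq> 0\<close> h(2,3), of sw "p mod 4" "p div 4" "q mod 4" "q div 4"
        "u mod 2" "u div 2" "v mod 2" "v div 2"] by (simp only: mod_mult_div_eq)
qed

section \<open>The representatives are Descartes configurations\<close>

lemma tangent_opposite_lines: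
  fixes n :: complex
  assumes "norm n = 1" "- b < a"
  shows "oc_interior (Half n a) \<inter> oc_interior (Half (- n) b) = {}"
    "tangent (circ_set (Half n a)) (circ_set (Half (- n) b))"
proof -
  show "oc_interior (Half n a) \<inter> oc_interior (Half (- n) b) = {}" using assms by auto
  have u: "\<not> bounded {z. n \<bullet> z = a}" "\<not> bounded {z. - n \<bullet> z = b}"
    using line_unbounded[of n a] line_unbounded[of "- n" b] assms by auto
  moreover have "{z. n \<bullet> z = a} \<inter> {z. - n \<bullet> z = b} = {}" using assms by auto
  moreover from this have "{z. n \<bullet> z = a} \<noteq> {z. - n \<bullet> z = b}" using u by force
  ultimately show "tangent (circ_set (Half n a)) (circ_set (Half (- n) b))" by (simp add: tangent_def)
qed

lemma tangent_line_disk: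
  fixes n :: complex
  assumes "norm n = 1" "r > 0" "n \<bullet> c + r = d"
  shows "oc_interior (Half n d) \<inter> oc_interior (Disk c r) = {}"
    "tangent (circ_set (Half n d)) (circ_set (Disk c r))"
proof -
  have nn: "n \<bullet> n = 1" using assms by (simp add: dot_square_norm)
  have "n \<bullet> z < d" if "dist c z < r" for z
  proof -
    have "n \<bullet> (z - c) \<le> norm n * norm (z - c)" by (rule norm_cauchy_schwarz)
    then show ?thesis using that assms by (simp add: inner_diff_right dist_norm norm_minus_commute)
  qed
  then show "oc_interior (Half n d) \<inter> oc_interior (Disk c r) = {}" by force
  have uniq: "z = c + r *\<^sub>R n" if "n \<bullet> z = d" "dist c z = r" for z
  proof -
    \<comment> \<open>Taken at \<open>z - c\<close>, this expansion gives r^2 - 2 r^2 + r^2 = 0, so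
      the contact point is unique.\<close>
    have "(a - r *\<^sub>R n) \<bullet> (a - r *\<^sub>R n) = a \<bullet> a - 2 * r * (n \<bullet> a) + r * r * (n \<bullet> n)" for a
      by (simp add: inner_complex_def algebra_simps)
    from this[of "z - c"]
    have "(z - c - r *\<^sub>R n) \<bullet> (z - c - r *\<^sub>R n) = (z - c) \<bullet> (z - c) - 2 * r * (n \<bullet> (z - c)) + r * r * (n \<bullet> n)" .
    also have "(z - c) \<bullet> (z - c) = r * r"
      using that by (simp add: dot_square_norm dist_norm norm_minus_commute power2_eq_square)
    also have "n \<bullet> (z - c) = r" using that assms by (simp add: inner_diff_right)
    finally have "z - c - r *\<^sub>R n = 0" using nn by simp
    then show ?thesis by (simp add: algebra_simps)
  qed
  have on: "n \<bullet> (c + r *\<^sub>R n) = d" "dist c (c + r *\<^sub>R n) = r"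
    using nn assms by (simp_all add: inner_add_right dist_norm)
  have "{z. n \<bullet> z = d} \<inter> sphere c r = {c + r *\<^sub>R n}"
  proof (intro equalityI subsetI)
    fix z assume "z \<in> {z. n \<bullet> z = d} \<inter> sphere c r"
    then show "z \<in> {c + r *\<^sub>R n}" using uniq[of z] by simp
  qed (use on in simp)
  moreover have "{z. n \<bullet> z = d} \<noteq> sphere c r"
    using line_unbounded[OF assms(1)] sphere_bounded by metis
  ultimately show "tangent (circ_set (Half n d)) (circ_set (Disk c r))" by (simp add: tangent_def)
qed

lemma tangent_equal_disks:
  assumes "r > 0" "dist c d = 2 * r"
  shows "oc_interior (Disk c r) \<inter> oc_interior (Disk d r) = {}"
    "tangent (circ_set (Disk c r)) (circ_set (Disk d r))"
proof -
  show "oc_interior (Disk c r) \<inter> oc_interior (Disk d r) = {}"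
    using disjoint_ballI[of r r c d] assms by simp
  have uniq: "z = (1/2) *\<^sub>R (c + d)" if "dist c z = r" "dist d z = r" for z
  proof -
    \<comment> \<open>Parallelogram law: with both distances equal to \<open>r\<close> and the
      centres \<open>2 * r\<close> apart, \<open>z\<close> must be the midpoint.\<close>
    have "(norm (a + b))\<^sup>2 + (norm (a - b))\<^sup>2 = 2 * (norm a)\<^sup>2 + 2 * (norm b)\<^sup>2" for a b :: complex
      unfolding cmod_power2 by (simp add: power2_eq_square algebra_simps)
    from this[of "z - c" "z - d"]
    have "(norm (z - c + (z - d)))\<^sup>2 + (norm (z - c - (z - d)))\<^sup>2 = 2 * (norm (z - c))\<^sup>2 + 2 * (norm (z - d))\<^sup>2" .
    moreover have "norm (z - c) = r" "norm (z - d) = r" "norm (z - c - (z - d)) = 2 * r"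
      using that assms by (simp_all add: dist_norm norm_minus_commute)
    ultimately have "norm (z - c + (z - d)) = 0" by (simp add: power2_eq_square)
    then show ?thesis by (simp add: complex_eq_iff)
  qed
  have on: "dist c ((1/2) *\<^sub>R (c + d)) = r" "dist d ((1/2) *\<^sub>R (c + d)) = r"
  proof -
    have "c - (1/2) *\<^sub>R (c + d) = (1/2) *\<^sub>R (c - d)" "d - (1/2) *\<^sub>R (c + d) = (1/2) *\<^sub>R (d - c)"
      by (simp_all add: complex_eq_iff field_simps)
    then show "dist c ((1/2) *\<^sub>R (c + d)) = r" "dist d ((1/2) *\<^sub>R (c + d)) = r"
      using assms by (simp_all add: dist_norm norm_minus_commute)
  qed
  have "sphere c r \<inter> sphere d r = {(1/2) *\<^sub>R (c + d)}"
  proof (intro equalityI subsetI)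
    fix z assume "z \<in> sphere c r \<inter> sphere d r"
    then show "z \<in> {(1/2) *\<^sub>R (c + d)}" using uniq[of z] by simp
  qed (use on in simp)
  moreover have "sphere c r \<noteq> sphere d r" using sphere_inj[of r r c d] assms by auto
  ultimately show "tangent (circ_set (Disk c r)) (circ_set (Disk d r))" by (simp add: tangent_def)
qed

lemma oo_descartes_rep:
  assumes "g > 0"
  shows "oo_descartes (rep (sw, g, X, Y))"
proof -
  define t n where "t = (if sw then \<i> else 1)" and "n = (if sw then 1 else \<i>)"
  define x y r :: real where "x = of_int X / of_int g" and "y = of_int Y / of_int g" and "r = 1 / of_int g"
  have r: "r > 0" using assms by (simp add: r_def)
  have nt: "norm n = 1" "norm t = 1" "n \<bullet> t = 0" "n \<bullet> n = 1"
    by (auto simp: n_def t_def inner_complex_def)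
  \<comment> \<open>In coordinates along \<open>n\<close> and \<open>t\<close>, the lines lie at
    heights \<open>y + r\<close> and \<open>y - r\<close>, the disks at height \<open>y\<close> on
    either side of \<open>x\<close>.\<close>
  define L M A B where "L = Half n (y + r)" and "M = Half (- n) (r - y)"
    and "A = Disk ((x + r) *\<^sub>R t + y *\<^sub>R n) r" and "B = Disk ((x - r) *\<^sub>R t + y *\<^sub>R n) r"
  have rep: "rep (sw, g, X, Y) 1 = L" "rep (sw, g, X, Y) 2 = M"
    "rep (sw, g, X, Y) 3 = A" "rep (sw, g, X, Y) 4 = B"
    by (simp_all add: Let_def t_def n_def x_def y_def r_def L_def M_def A_def B_def add_divide_distrib diff_divide_distrib)
  let ?ok = "\<lambda>C D. oc_interior C \<inter> oc_interior D = {} \<and> tangent (circ_set C) (circ_set D)"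
  have LM: "?ok L M" unfolding L_def M_def
    by (intro conjI tangent_opposite_lines) (use nt r in auto)
  have LA: "?ok L A" and LB: "?ok L B" and MA: "?ok M A" and MB: "?ok M B" unfolding L_def M_def A_def B_def
    by (intro conjI tangent_line_disk; use nt r in \<open>simp add: inner_add_right inner_diff_right\<close>)+
  have AB: "?ok A B" unfolding A_def B_def
  proof (intro conjI tangent_equal_disks)
    have "(x + r) *\<^sub>R t + y *\<^sub>R n - ((x - r) *\<^sub>R t + y *\<^sub>R n) = (2 * r) *\<^sub>R t"
      by (simp add: complex_eq_iff algebra_simps)
    then show "dist ((x + r) *\<^sub>R t + y *\<^sub>R n) ((x - r) *\<^sub>R t + y *\<^sub>R n) = 2 * r"
      using r nt by (simp add: dist_norm)
    then show "dist ((x + r) *\<^sub>R t + y *\<^sub>R n) ((x - r) *\<^sub>R t + y *\<^sub>R n) = 2 * r" .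
  qed (use r in auto)
  have valid: "valid_oc L" "valid_oc M" "valid_oc A" "valid_oc B"
    using nt r by (simp_all add: L_def M_def A_def B_def)
  have sym: "?ok D C" if "?ok C D" for C D
    using that by (simp add: Int_commute tangent_commute[of "circ_set D"])
  have "pos_descartes (rep (sw, g, X, Y))"
    using valid LM LA LB MA MB AB sym[OF LM] sym[OF LA] sym[OF LB] sym[OF MA] sym[OF MB] sym[OF AB]
    unfolding pos_descartes_def forall_4 rep by (simp del: rep.simps)
  then show ?thesis by (simp add: oo_descartes_def)
qed

section \<open>Rows of the representatives and their lattices\<close>

fun rep_row :: "rep_index \<Rightarrow> nat \<Rightarrow> int_row" where
  "rep_row (sw, g, X, Y) k =
    (let (p, q, x, y) =
      (if k = 1 then (2 * (Y + 1) div g, 0, 0, 1)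
       else if k = 2 then (2 * (1 - Y) div g, 0, 0, -1)
       else if k = 3 then (((X + 1) * (X + 1) + Y * Y - 1) div g, g, X + 1, Y)
       else (((X - 1) * (X - 1) + Y * Y - 1) div g, g, X - 1, Y))
     in if sw then (p, q, y, x) else (p, q, x, y))"

lemma wrow_rep_real:
  fixes g X Y :: int
  assumes "g > 0"
  defines "G \<equiv> real_of_int g" and "x \<equiv> real_of_int X" and "y \<equiv> real_of_int Y"
  shows "wrow (rep (sw, g, X, Y) 1) = vector [2 * (y + 1) / G, 0, if sw then 1 else 0, if sw then 0 else 1]" (is ?r1)
    "wrow (rep (sw, g, X, Y) 2) = vector [2 * (1 - y) / G, 0, if sw then -1 else 0, if sw then 0 else -1]" (is ?r2)
    "wrow (rep (sw, g, X, Y) 3) = vector [((x + 1)\<^sup>2 + y\<^sup>2 - 1) / G, G, if sw then y else x + 1, if sw then x + 1 else y]" (is ?r3)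
    "wrow (rep (sw, g, X, Y) 4) = vector [((x - 1)\<^sup>2 + y\<^sup>2 - 1) / G, G, if sw then y else x - 1, if sw then x - 1 else y]" (is ?r4)
proof -
  have N: "(cmod (a *\<^sub>R 1 + b *\<^sub>R \<i>))\<^sup>2 = a\<^sup>2 + b\<^sup>2" "(cmod (a *\<^sub>R \<i> + b *\<^sub>R 1))\<^sup>2 = a\<^sup>2 + b\<^sup>2" for a b
    by (simp_all add: cmod_power2)
  have G: "G > 0" using assms by (simp add: G_def)
  then have d: "G * ((a / G)\<^sup>2 + (b / G)\<^sup>2) - 1 / G = (a\<^sup>2 + b\<^sup>2 - 1) / G" for a b
    by (simp add: field_simps power2_eq_square)
  show ?r1 ?r2 ?r3 ?r4
    unfolding vec4_eq_iff rep.simps Let_def G_def[symmetric] x_def[symmetric] y_def[symmetric]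
    using G by (auto simp: N d)
qed

text \<open>The divisions by \<open>g\<close> in \<open>rep_row\<close> are exact for each of the
  fourteen indices.\<close>

lemma wrow_rep:
  assumes "i \<in> set rep_indices"
  shows "wrow (rep i 1) = row_vec (rep_row i 1)" "wrow (rep i 2) = row_vec (rep_row i 2)"
    "wrow (rep i 3) = row_vec (rep_row i 3)" "wrow (rep i 4) = row_vec (rep_row i 4)"
  using assms unfolding rep_indices_def
  by (auto simp: wrow_rep_real simp del: rep.simps)

lemma row_lattice_rep:
  assumes "g > 0"
  shows "row_vec r \<in> row_lattice (rep (sw, g, X, Y)) \<longleftrightarrow> lat_mem (sw, g, X, Y) r"
proof -
  obtain p q u v where r: "r = (p, q, u, v)" by (cases r)
  define x y where "x = (if sw then v else u)" and "y = (if sw then u else v)"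
  let ?N = "X * X + Y * Y + 2 * Y"
  have eq: "row_vec r = (\<Sum>k\<in>UNIV. of_int (c k) *\<^sub>R wrow (rep (sw, g, X, Y) k)) \<longleftrightarrow>
    p * g = 2 * (Y + 1) * c 1 + 2 * (1 - Y) * c 2 + ((X + 1)\<^sup>2 + Y\<^sup>2 - 1) * c 3 + ((X - 1)\<^sup>2 + Y\<^sup>2 - 1) * c 4
    \<and> q = g * (c 3 + c 4) \<and> x = (X + 1) * c 3 + (X - 1) * c 4 \<and> y = c 1 - c 2 + Y * (c 3 + c 4)"
    for c :: "4 \<Rightarrow> int"
  proof -
    have 1: "of_int p = of_int (c 1) * (2 * (Y + 1) / g) + of_int (c 2) * (2 * (1 - Y) / g)
        + of_int (c 3) * (((X + 1)\<^sup>2 + Y\<^sup>2 - 1) / g) + of_int (c 4) * (((X - 1)\<^sup>2 + Y\<^sup>2 - 1) / real_of_int g)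
      \<longleftrightarrow> p * g = 2 * (Y + 1) * c 1 + 2 * (1 - Y) * c 2 + ((X + 1)\<^sup>2 + Y\<^sup>2 - 1) * c 3 + ((X - 1)\<^sup>2 + Y\<^sup>2 - 1) * c 4"
      (is "?l \<longleftrightarrow> ?a = ?b")
    proof -
      have "of_int (c 1) * (2 * (Y + 1) / g) + of_int (c 2) * (2 * (1 - Y) / g)
        + of_int (c 3) * (((X + 1)\<^sup>2 + Y\<^sup>2 - 1) / g) + of_int (c 4) * (((X - 1)\<^sup>2 + Y\<^sup>2 - 1) / real_of_int g)
        = real_of_int ?b / g"
        using assms by (simp add: field_simps)
      then have "?l \<longleftrightarrow> of_int p = real_of_int ?b / g" by (simp only:)
      also have "\<dots> \<longleftrightarrow> real_of_int ?a = real_of_int ?b" using assms by (simp add: eq_divide_eq)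
      finally have "?l \<longleftrightarrow> real_of_int ?a = real_of_int ?b" .
      then show ?thesis by (simp only: of_int_eq_iff)
    qed
    have 2: "real_of_int q = of_int (c 3) * g + of_int (c 4) * g \<longleftrightarrow> q = g * (c 3 + c 4)"
      by (simp add: algebra_simps flip: of_int_mult of_int_add)
    have 3: "real_of_int x = of_int (c 3) * (X + 1) + of_int (c 4) * (X - 1)
      \<longleftrightarrow> x = (X + 1) * c 3 + (X - 1) * c 4"
    proof -
      have "of_int (c 3) * (X + 1) + of_int (c 4) * (X - 1) = real_of_int ((X + 1) * c 3 + (X - 1) * c 4)"
        by (simp add: mult.commute)
      then show ?thesis by (simp only: of_int_eq_iff)
    qed
    have 4: "real_of_int y = of_int (c 1) - of_int (c 2) + of_int (c 3) * Y + of_int (c 4) * Y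
      \<longleftrightarrow> y = c 1 - c 2 + Y * (c 3 + c 4)"
      by (simp add: algebra_simps flip: of_int_mult of_int_add of_int_diff)
    show ?thesis unfolding 1[symmetric] 2[symmetric] 3[symmetric] 4[symmetric]
      by (auto simp: r sum_4 vec4_eq_iff wrow_rep_real[OF assms] x_def y_def simp del: rep.simps)
  qed
  \<comment> \<open>Dictionary to the coefficients: \<open>k = c 3 + c 4\<close>,
    \<open>a = - c 4\<close>, \<open>b = c 2\<close>; the remaining \<open>c 1\<close> is then
    determined by \<open>y\<close>.\<close>
  have mem: "lat_mem (sw, g, X, Y) r \<longleftrightarrow> (\<exists>k a b. q = g * k \<and> x = (X + 1) * k + 2 * a \<and>
      p * g = 2 * X * x + 2 * (Y + 1) * y - ?N * k + 4 * b)" (is "_ \<longleftrightarrow> ?R")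
  proof -
    have "lat_mem (sw, g, X, Y) r \<longleftrightarrow> q mod g = 0 \<and> (x - (X + 1) * (q div g)) mod 2 = 0 \<and>
        (p * g - 2 * X * x - 2 * (Y + 1) * y + ?N * (q div g)) mod 4 = 0"
      by (simp add: r x_def y_def Let_def)
    also have "\<dots> \<longleftrightarrow> g dvd q \<and> (\<exists>a. x - (X + 1) * (q div g) = 2 * a) \<and>
        (\<exists>b. p * g - 2 * X * x - 2 * (Y + 1) * y + ?N * (q div g) = 4 * b)"
      by (simp only: mod_eq_0_iff_dvd dvd_def)
    also have "\<dots> \<longleftrightarrow> ?R"
    proof
      assume L: "g dvd q \<and> (\<exists>a. x - (X + 1) * (q div g) = 2 * a) \<and>
        (\<exists>b. p * g - 2 * X * x - 2 * (Y + 1) * y + ?N * (q div g) = 4 * b)"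
      then have "q = g * (q div g)" by simp
      moreover obtain a b where "x - (X + 1) * (q div g) = 2 * a"
        "p * g - 2 * X * x - 2 * (Y + 1) * y + ?N * (q div g) = 4 * b" using L by blast
      then have "x = (X + 1) * (q div g) + 2 * a"
        "p * g = 2 * X * x + 2 * (Y + 1) * y - ?N * (q div g) + 4 * b" by linarith+
      ultimately show ?R by blast
    next
      assume ?R
      then obtain k a b where k: "q = g * k" "x = (X + 1) * k + 2 * a"
        "p * g = 2 * X * x + 2 * (Y + 1) * y - ?N * k + 4 * b" by blast
      then have "q div g = k" using assms by simp
      then show "g dvd q \<and> (\<exists>a. x - (X + 1) * (q div g) = 2 * a) \<and>
        (\<exists>b. p * g - 2 * X * x - 2 * (Y + 1) * y + ?N * (q div g) = 4 * b)"
        using k by (intro conjI exI[of _ a] exI[of _ b]) auto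
    qed
    finally show ?thesis .
  qed
  show ?thesis
  proof
    assume "row_vec r \<in> row_lattice (rep (sw, g, X, Y))"
    then obtain c :: "4 \<Rightarrow> int" where
      "row_vec r = (\<Sum>k\<in>UNIV. of_int (c k) *\<^sub>R wrow (rep (sw, g, X, Y) k))"
      unfolding row_lattice_def by blast
    then have pg: "p * g = 2 * (Y + 1) * c 1 + 2 * (1 - Y) * c 2 + ((X + 1)\<^sup>2 + Y\<^sup>2 - 1) * c 3 + ((X - 1)\<^sup>2 + Y\<^sup>2 - 1) * c 4"
      and q: "q = g * (c 3 + c 4)" and x: "x = (X + 1) * c 3 + (X - 1) * c 4"
      and y: "y = c 1 - c 2 + Y * (c 3 + c 4)"
      unfolding eq by blast+
    have "x = (X + 1) * (c 3 + c 4) + 2 * (- c 4)" unfolding x by (simp add: algebra_simps)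
    moreover have "p * g = 2 * X * x + 2 * (Y + 1) * y - ?N * (c 3 + c 4) + 4 * c 2"
      unfolding pg x y by (simp add: power2_eq_square algebra_simps)
    moreover note q
    ultimately show "lat_mem (sw, g, X, Y) r" unfolding mem by blast
  next
    assume "lat_mem (sw, g, X, Y) r"
    then obtain k a b where k: "q = g * k" "x = (X + 1) * k + 2 * a"
        "p * g = 2 * X * x + 2 * (Y + 1) * y - ?N * k + 4 * b" unfolding mem by blast
    \<comment> \<open>The inverse of that dictionary; the last branch is index 4.\<close>
    define c :: "4 \<Rightarrow> int" where
      "c i = (if i = 1 then y - Y * k + b else if i = 2 then b else if i = 3 then k + a else - a)" for i
    have "row_vec r = (\<Sum>k\<in>UNIV. of_int (c k) *\<^sub>R wrow (rep (sw, g, X, Y) k))"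
      unfolding eq unfolding k(3) using k(1,2)
      by (simp add: c_def power2_eq_square algebra_simps)
    then show "row_vec r \<in> row_lattice (rep (sw, g, X, Y))" unfolding row_lattice_def by blast
  qed
qed

section \<open>Separation and covering by the fourteen lattices\<close>

lemma rep_indices_pos: "(sw, g, X, Y) \<in> set rep_indices \<Longrightarrow> g > 0"
  by (auto simp: rep_indices_def)

lemma row_lattice_rep_index:
  assumes "i \<in> set rep_indices"
  shows "row_vec r \<in> row_lattice (rep i) \<longleftrightarrow> lat_mem i r"
proof -
  obtain sw g X Y where i: "i = (sw, g, X, Y)" by (cases i)
  show ?thesis unfolding i by (rule row_lattice_rep) (use assms i rep_indices_pos in blast)
qed

text \<open>Lattices coincide when each contains the generating rows of the other, so distinctness
  is a finite evaluation over all pairs.\<close>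

lemma rep_lattices_distinct:
  "list_all (\<lambda>i. list_all (\<lambda>j. list_all (\<lambda>k. lat_mem j (rep_row i k) \<and> lat_mem i (rep_row j k)) [1,2,3,4]
    \<longrightarrow> i = j) rep_indices) rep_indices"
  unfolding rep_indices_def by code_simp

lemma int_row_of_bil:
  assumes "bil (row_vec (p, q, u, v)) (row_vec (p', q', u', v')) = of_int c"
  shows "2 * u * u' + 2 * v * v' - p * q' - p' * q = 2 * c"
proof -
  have "real_of_int (2 * u * u' + 2 * v * v' - p * q' - p' * q) = of_int (2 * c)"
    using assms by (simp add: bil_def field_simps)
  then show ?thesis by (simp only: of_int_eq_iff)
qed

lemma compat_residue: "compat (residue r) (residue s) = compat r s"
proof -
  obtain p q u v where r: "r = (p, q, u, v)" by (cases r)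
  obtain p' q' u' v' where s: "s = (p', q', u', v')" by (cases s)
  have e: "(2 * (u mod 2) * (u' mod 2)) mod 4 = (2 * u * u') mod 4" for u u' :: int
  proof -
    define k k' m m' where "k = u div 2" and "k' = u' div 2" and "m = u mod 2" and "m' = u' mod 2"
    then have "u = m + 2 * k" "u' = m' + 2 * k'" by simp_all
    then have "2 * u * u' = 2 * m * m' + 4 * (m * k' + k * m' + 2 * k * k')" by (simp add: algebra_simps)
    then show ?thesis by (simp only: mod_mult_self2 m_def m'_def)
  qed
  have f: "(p mod 4) * (q mod 4) mod 4 = p * q mod 4" for p q :: int by (rule mod_mult_eq)
  show ?thesis unfolding r s residue.simps compat.simps
    by (intro arg_cong[of _ _ "\<lambda>x. x = 0"] mod_add_cong mod_diff_cong e f refl)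
qed

lemma residue_in_residue_rows:
  assumes "u * u + v * v - p * q = 1"
  shows "residue (p, q, u, v) \<in> set residue_rows"
proof -
  have e: "(u mod 2) * (u mod 2) mod 4 = u * u mod 4" for u :: int
  proof (cases "even u")
    case True
    then show ?thesis by (auto elim!: evenE)
  next
    case False
    then obtain k where "u = 2 * k + 1" by (elim oddE)
    then have "u * u = 1 + 4 * (k * k + k)" by (simp add: algebra_simps)
    then have "u * u mod 4 = 1" by (simp only: mod_mult_self2) simp
    then show ?thesis using False by (simp add: odd_iff_mod_2_eq_one)
  qed
  have "((u mod 2) * (u mod 2) + (v mod 2) * (v mod 2) - (p mod 4) * (q mod 4) - 1) mod 4
      = (u * u + v * v - p * q - 1) mod 4"
    by (intro mod_add_cong mod_diff_cong e mod_mult_eq refl)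
  also have "\<dots> = 0" using assms by simp
  finally have eq: "case residue (p, q, u, v) of (p, q, u, v) \<Rightarrow> (u * u + v * v - p * q - 1) mod 4 = 0"
    by simp
  have 4: "p mod 4 \<in> set [0,1,2,3]" for p :: int by (simp, presburger)
  have 2: "u mod 2 \<in> set [0,1]" for u :: int by auto
  have "residue (p, q, u, v) \<in> set (List.product [0,1,2,3] (List.product [0,1,2,3] (List.product [0,1] [0,1])))"
    unfolding residue.simps set_product by (intro SigmaI 4 2)
  then show ?thesis unfolding residue_rows_def set_filter using eq by blast
qed

text \<open>The residues of the four rows are pairwise compatible and have norm 1 modulo 4, so the
  search supplies an index whose test they all pass; the rows themselves then pass it too.\<close>

lemma integral_rows_covered:
  assumes D: "oo_descartes D" and int: "integral_W D"
  shows "\<exists>i\<in>set rep_indices. \<forall>k. wrow (D k) \<in> row_lattice (rep i)"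
proof -
  have "\<exists>r. wrow (D k) = row_vec r" for k
  proof -
    have "wrow (D k) $ j \<in> \<int>" for j using int by (simp add: integral_W_def Wmat_nth)
    then obtain p q u v where "wrow (D k) $ 1 = of_int p" "wrow (D k) $ 2 = of_int q"
      "wrow (D k) $ 3 = of_int u" "wrow (D k) $ 4 = of_int v" by (meson Ints_cases)
    then have "wrow (D k) = row_vec (p, q, u, v)" by (simp add: vec4_eq_iff)
    then show ?thesis by blast
  qed
  then obtain R where R: "\<And>k. wrow (D k) = row_vec (R k)" by metis
  have res: "residue (R k) \<in> set residue_rows" for k
  proof -
    obtain p q u v where r: "R k = (p, q, u, v)" by (cases "R k")
    have "2 * u * u + 2 * v * v - p * q - p * q = 2 * 1"
      using oo_descartes_bil[OF D, of k k] R[of k] by (intro int_row_of_bil) (simp add: r)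
    then have "u * u + v * v - p * q = 1" by simp
    then show ?thesis unfolding r by (rule residue_in_residue_rows)
  qed
  have com: "compat (residue (R k)) (residue (R l))" if "k \<noteq> l" for k l
  proof -
    obtain p q u v where r: "R k = (p, q, u, v)" by (cases "R k")
    obtain p' q' u' v' where s: "R l = (p', q', u', v')" by (cases "R l")
    have "2 * u * u' + 2 * v * v' - p * q' - p' * q = 2 * -1"
      using oo_descartes_bil[OF D, of k l] R[of k] R[of l] that
      by (intro int_row_of_bil) (simp add: r s)
    then have "compat (R k) (R l)" by (simp add: r s)
    then show ?thesis by (simp add: compat_residue)
  qed
  let ?xs = "[residue (R 1), residue (R 2), residue (R 3), residue (R 4)]"
  have "compat (?xs ! i) (?xs ! j)" if "i < j" "j < 4" for i j
  proof -
    have "j \<in> {1,2,3}" "i \<in> {0,1,2}" using that by auto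
    then show ?thesis using that com by auto
  qed
  then obtain i where i: "i \<in> set rep_indices" "\<forall>x\<in>set ?xs. lat_mem i x"
    using cliques_coveredD[OF cliques_covered_residues, of ?xs] res by auto
  then have "\<forall>k. lat_mem i (residue (R k))" unfolding forall_4 by simp
  then show ?thesis using i(1) R by (auto simp: lat_mem_residue row_lattice_rep_index intro!: bexI[of _ i])
qed

theorem theorem8p1:
  shows "card {super_packing D | D. oo_descartes D \<and> integral_W D} = 14
       \<and> card {superA_orbit D | D. oo_descartes D \<and> integral_W D} = 672"
proof -
  have rep: "oo_descartes (rep i) \<and> integral_W (rep i)" if i: "i \<in> set rep_indices" for i
  proof
    obtain sw g X Y where "i = (sw, g, X, Y)" by (cases i)
    then show "oo_descartes (rep i)" using i oo_descartes_rep rep_indices_pos by blast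
    have ints: "row_vec r $ j \<in> \<int>" for r j by (cases r) (use exhaust_4[of j] in auto)
    show "integral_W (rep i)"
      unfolding integral_W_def Wmat_nth forall_4 wrow_rep[OF i] by (simp only: ints simp_thms)
  qed
  have sep: "i = j" if i: "i \<in> set rep_indices" and j: "j \<in> set rep_indices"
    and k: "\<forall>k. wrow (rep i k) \<in> row_lattice (rep j) \<and> wrow (rep j k) \<in> row_lattice (rep i)" for i j
  proof -
    have "list_all (\<lambda>k. lat_mem j (rep_row i k) \<and> lat_mem i (rep_row j k)) [1,2,3,4]"
      using k unfolding forall_4 wrow_rep[OF i] wrow_rep[OF j]
        row_lattice_rep_index[OF i] row_lattice_rep_index[OF j] by simp
    then show ?thesis using rep_lattices_distinct i j unfolding list_all_iff by blast
  qed
  have "card (set rep_indices) = 14" by (simp add: rep_indices_def)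
  moreover have "card {super_packing D | D. oo_descartes D \<and> integral_W D} = card (set rep_indices)"
    "card {superA_orbit D | D. oo_descartes D \<and> integral_W D} = 48 * card (set rep_indices)"
    by (rule orbit_count[where f = rep], rule finite_set, erule rep, erule (1) integral_rows_covered,
        erule (2) sep)+
  ultimately show ?thesis by simp
qed

end
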